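(* Let $\mathcal{B}$ be a complete Boolean algebra, let $Q$ be the Stone space of $\mathcal{B}$, let $X$ be an ideal in $C(Q)$ and let $Y$ be a quasi-normed solid space in $L^0(\mathcal{B})$. Then any band preserving derivation $\delta\colon X\to Y$ is trivial, i.e. $\delta=0$.
   Context: $L^0(\mathcal{B}):=C_\infty(Q)$ denotes the set of all continuous functions $x:Q\to[-\infty,+\infty]$ taking the values $\pm\infty$ at most on a nowhere dense set; with the usual operations (pointwise on a dense open set, extended by continuity) and pointwise order it is a commutative real algebra and a universally complete vector lattice. $C(Q)\subset L^0(\mathcal{B})$ is the subalgebra of continuous real-valued functions. $\mathcal{B}$ is identified with the Boolean algebra of idempotents of $L^0(\mathcal{B})$ (characteristic functions of clopen sets); $\mathbf{1}$ is the constant function one. Support: for $x\in L^0(\mathcal{B})$, $s(x)=\mathbf{1}-\sup\{e\in\mathcal{B}:ex=0\}\in\mathcal{B}$. A solid space in $L^0(\mathcal{B})$ is a non-zero linear subspace $Y$ such that $x\in Y$, $y\in L^0(\mathcal{B})$, $|y|\leqslant|x|$ imply $y\in Y$ (then $ay\in Y$ for $a\in C(Q)$, $y\in Y$). A quasi-norm on $Y$ is a map $\|\cdot\|:Y\to\mathbb{R}$ for which there is a constant $C\geqslant1$ such that for all $x,y\in Y$ and scalars $\alpha$: $\|x\|\geqslant0$, with $\|x\|=0$ iff $x=0$; $\|\alpha x\|=|\alpha|\|x\|$; $\|x+y\|\leqslant C(\|x\|+\|y\|)$. It is monotone if $|y|\leqslant|x|$ implies $\|y\|\leqslant\|x\|$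 ($x,y\in Y$). A quasi-normed solid space is a solid space equipped with a monotone quasi-norm (completeness is not required). An ideal in $C(Q)$ is a subalgebra $X\subset C(Q)$ with $xa\in X$ for all $x\in C(Q)$, $a\in X$. A derivation $\delta:X\to Y$ is a linear map with $\delta(xy)=\delta(x)y+x\delta(y)$ for all $x,y\in X$; it is band preserving if $s(\delta(x))\leqslant s(x)$ for all $x\in X$. *)

theory Defs
  imports "HOL-Analysis.Analysis"
begin

section \<open>Complete Boolean algebras and their Stone spaces\<close>

text \<open>
  The library class \<open>complete_boolean_algebra\<close> extends \<open>complete_distrib_lattice\<close>,
  i.e. it demands \<^emph>\<open>complete\<close> distributivity, which forces the algebra to be atomic.
  A complete Boolean algebra in the usual sense is only a Boolean algebra in which all
  suprema and infima exist.
\<close>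

class complete_bool_alg = boolean_algebra + complete_lattice

definition ultrafilter :: "'b::boolean_algebra set \<Rightarrow> bool" where
  "ultrafilter F \<longleftrightarrow> top \<in> F \<and> bot \<notin> F \<and>
     (\<forall>a b. a \<in> F \<and> b \<in> F \<longrightarrow> inf a b \<in> F) \<and>
     (\<forall>a b. a \<in> F \<and> a \<le> b \<longrightarrow> b \<in> F) \<and>
     (\<forall>a. a \<in> F \<or> - a \<in> F)"

definition stone_clopen :: "'b::boolean_algebra \<Rightarrow> 'b set set" where
  "stone_clopen b = {F. ultrafilter F \<and> b \<in> F}"

definition stone_space :: "'b::boolean_algebra set topology" where
  "stone_space = topology_generated_by (range stone_clopen)"

definition dense_open_in :: "'a topology \<Rightarrow> 'a set \<Rightarrow> bool" where
  "dense_open_in T U \<longleftrightarrow> openin T U \<and> T closure_of U = topspace T"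

definition nowhere_dense_in :: "'a topology \<Rightarrow> 'a set \<Rightarrow> bool" where
  "nowhere_dense_in T S \<longleftrightarrow> T interior_of (T closure_of S) = {}"

subsection \<open>Basic facts\<close>

lemma ultrafilterD:
  assumes "ultrafilter F"
  shows "top \<in> F" "bot \<notin> F" "a \<in> F \<Longrightarrow> b \<in> F \<Longrightarrow> inf a b \<in> F"
    "a \<in> F \<Longrightarrow> a \<le> b \<Longrightarrow> b \<in> F" "a \<in> F \<or> - a \<in> F"
  using assms unfolding ultrafilter_def by blast+

lemma ultrafilter_compl: "ultrafilter F \<Longrightarrow> - a \<in> F \<longleftrightarrow> a \<notin> F"
  by (metis inf_compl_bot ultrafilterD(2,3,5))

lemma topspace_stone: "topspace stone_space = {F. ultrafilter F}"
proof -
  have "topspace stone_space = \<Union>(range stone_clopen)"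
    unfolding stone_space_def by simp
  also have "\<dots> = {F. ultrafilter F}"
    using ultrafilterD(1) by (auto simp: stone_clopen_def)
  finally show ?thesis .
qed

lemma stone_clopen_inf: "stone_clopen (inf a b) = stone_clopen a \<inter> stone_clopen b"
  by (auto simp: stone_clopen_def intro: ultrafilterD(3) ultrafilterD(4) inf_le1 inf_le2)

lemma stone_clopen_compl: "stone_clopen (- a) = topspace stone_space - stone_clopen a"
  by (auto simp: stone_clopen_def topspace_stone ultrafilter_compl)

lemma openin_stone_clopen: "openin stone_space (stone_clopen a)"
  unfolding stone_space_def by (rule topology_generated_by_Basis) simp

lemma closedin_stone_clopen: "closedin stone_space (stone_clopen a)"
proof -
  have "stone_clopen a \<subseteq> topspace stone_space"
    by (auto simp: stone_clopen_def topspace_stone)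
  then show ?thesis
    unfolding closedin_def using openin_stone_clopen[of "- a"] stone_clopen_compl[of a] by simp
qed

lemma stone_base:
  assumes "openin stone_space U" "F \<in> U"
  shows "\<exists>b. F \<in> stone_clopen b \<and> stone_clopen b \<subseteq> U"
proof -
  have "generate_topology_on (range stone_clopen) U"
    using assms(1) by (simp add: stone_space_def openin_topology_generated_by_iff)
  then have "\<forall>F\<in>U. \<exists>b. F \<in> stone_clopen b \<and> stone_clopen b \<subseteq> U"
  proof induction
    case (Int a b)
    show ?case
    proof
      fix F assume "F \<in> a \<inter> b"
      then obtain c d where "F \<in> stone_clopen c" "stone_clopen c \<subseteq> a"
        "F \<in> stone_clopen d" "stone_clopen d \<subseteq> b" using Int by blast
      then show "\<exists>b'. F \<in> stone_clopen b' \<and> stone_clopen b' \<subseteq> a \<inter> b"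
        by (intro exI[of _ "inf c d"]) (auto simp: stone_clopen_inf)
    qed
  qed blast+
  with assms(2) show ?thesis by blast
qed

lemma ultrafilter_exists:
  fixes a :: "'b::boolean_algebra"
  assumes "a \<noteq> bot"
  shows "\<exists>F. ultrafilter F \<and> a \<in> F"
proof -
  define P where "P = {F :: 'b set. a \<in> F \<and> bot \<notin> F \<and>
     (\<forall>a b. a \<in> F \<and> b \<in> F \<longrightarrow> inf a b \<in> F) \<and> (\<forall>a b. a \<in> F \<and> a \<le> b \<longrightarrow> b \<in> F)}"
  have "{b. a \<le> b} \<in> P"
    unfolding P_def using assms by (auto simp: bot_unique)
  then have ne: "P \<noteq> {}" by blast
  have "\<exists>M\<in>P. \<forall>X\<in>P. M \<subseteq> X \<longrightarrow> X = M"
  proof (rule subset_Zorn_nonempty[OF ne])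
    fix C assume C: "C \<noteq> {}" "subset.chain P C"
    then have CP: "\<And>X. X \<in> C \<Longrightarrow> X \<in> P" and ch: "\<And>X Y. X \<in> C \<Longrightarrow> Y \<in> C \<Longrightarrow> X \<subseteq> Y \<or> Y \<subseteq> X"
      unfolding subset_chain_def by blast+
    have 1: "inf x y \<in> \<Union>C" if "x \<in> \<Union>C" "y \<in> \<Union>C" for x y
    proof -
      from that obtain X Y where XY: "X \<in> C" "x \<in> X" "Y \<in> C" "y \<in> Y" by blast
      then obtain Z where "Z \<in> C" "x \<in> Z" "y \<in> Z" using ch by blast
      then show ?thesis using CP[of Z] unfolding P_def by blast
    qed
    have 2: "a \<in> \<Union>C" "bot \<notin> \<Union>C" using C(1) CP unfolding P_def by blast+
    have 3: "y \<in> \<Union>C" if "x \<in> \<Union>C" "x \<le> y" for x y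
      using that CP unfolding P_def by blast
    show "\<Union>C \<in> P" unfolding P_def using 1 2 3 by blast
  qed
  then obtain M where M: "M \<in> P" and max: "\<And>X. X \<in> P \<Longrightarrow> M \<subseteq> X \<Longrightarrow> X = M" by blast
  have Mi: "a \<in> M" "bot \<notin> M" "\<And>x y. x \<in> M \<Longrightarrow> y \<in> M \<Longrightarrow> inf x y \<in> M"
    "\<And>x y. x \<in> M \<Longrightarrow> x \<le> y \<Longrightarrow> y \<in> M"
    using M unfolding P_def by blast+
  have "x \<in> M \<or> - x \<in> M" for x
  proof (rule ccontr)
    assume neg: "\<not> ?thesis"
    define N where "N = {y. \<exists>m\<in>M. inf m x \<le> y}"
    have nb: "bot \<notin> N"
    proof
      assume "bot \<in> N"
      then obtain m where "m \<in> M" "inf m x = bot" unfolding N_def by (auto simp: bot_unique)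
      then have "m \<le> - x" by (simp add: inf_shunt)
      with Mi(4) \<open>m \<in> M\<close> neg show False by blast
    qed
    have 1: "inf y z \<in> N" if "y \<in> N" "z \<in> N" for y z
    proof -
      from that obtain m n where mn: "m \<in> M" "n \<in> M" "inf m x \<le> y" "inf n x \<le> z"
        unfolding N_def by blast
      have "inf (inf m n) x \<le> inf (inf m x) (inf n x)" by (simp add: le_infI1 le_infI2)
      also have "\<dots> \<le> inf y z" using mn by (intro inf_mono)
      finally show ?thesis unfolding N_def using Mi(3) mn(1,2) by blast
    qed
    have MN: "M \<subseteq> N" unfolding N_def by (auto intro!: bexI intro: le_infI1)
    have "N \<in> P"
      unfolding P_def using nb 1 MN Mi(1) by (auto simp: N_def intro: order_trans)
    with max MN have "N = M" by blast
    moreover have "x \<in> N" unfolding N_def using Mi(1) by (auto intro!: bexI[of _ a])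
    ultimately show False using neg by blast
  qed
  moreover have "top \<in> M" using Mi(1,4) top_greatest by blast
  ultimately have "ultrafilter M" unfolding ultrafilter_def using Mi by blast
  with Mi(1) show ?thesis by blast
qed

lemma stone_clopen_eq_empty: "stone_clopen b = {} \<longleftrightarrow> b = bot"
  using ultrafilter_exists ultrafilterD(2) unfolding stone_clopen_def by blast

text \<open>Completeness of the algebra makes its Stone space extremally disconnected.\<close>

lemma stone_extremally_disconnected:
  fixes U :: "'b::complete_bool_alg set set"
  assumes U: "openin stone_space U"
  shows "openin stone_space (stone_space closure_of U)"
proof -
  define s where "s = Sup {b. stone_clopen b \<subseteq> U}"
  have "stone_space closure_of U = stone_clopen s"
  proof (rule equalityI)
    have "U \<subseteq> stone_clopen s"
    proof
      fix F assume "F \<in> U"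
      with stone_base[OF U] obtain b where b: "F \<in> stone_clopen b" "stone_clopen b \<subseteq> U" by blast
      then have "b \<le> s" unfolding s_def by (auto intro: Sup_upper)
      with b(1) show "F \<in> stone_clopen s" by (auto simp: stone_clopen_def intro: ultrafilterD(4))
    qed
    then show "stone_space closure_of U \<subseteq> stone_clopen s"
      by (rule closure_of_minimal) (rule closedin_stone_clopen)
  next
    show "stone_clopen s \<subseteq> stone_space closure_of U"
    proof
      fix F assume F: "F \<in> stone_clopen s"
      have "\<exists>y. y \<in> U \<and> y \<in> T" if T: "F \<in> T" "openin stone_space T" for T
      proof (rule ccontr)
        assume disj: "\<not> ?thesis"
        from stone_base[OF T(2,1)] obtain c where c: "F \<in> stone_clopen c" "stone_clopen c \<subseteq> T" by blast
        have "b \<le> - c" if "stone_clopen b \<subseteq> U" for b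
        proof -
          have "stone_clopen (inf b c) = {}" using that c(2) disj by (auto simp: stone_clopen_inf)
          then have "inf b c = bot" by (simp add: stone_clopen_eq_empty)
          then show ?thesis by (simp add: inf_shunt)
        qed
        then have "s \<le> - c" unfolding s_def by (auto intro: Sup_least)
        moreover have "ultrafilter F" "s \<in> F" "c \<in> F"
          using F c(1) by (simp_all add: stone_clopen_def)
        ultimately show False
          using ultrafilterD(4)[of F s "- c"] ultrafilter_compl[of F c] by simp
      qed
      with F show "F \<in> stone_space closure_of U"
        by (auto simp: in_closure_of stone_clopen_def topspace_stone)
    qed
  qed
  then show ?thesis by (simp add: openin_stone_clopen)
qed

lemma dense_open_in_Int:
  assumes "dense_open_in T U" "dense_open_in T V"
  shows "dense_open_in T (U \<inter> V)"
  unfolding dense_open_in_def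
proof
  show "openin T (U \<inter> V)" using assms by (auto simp: dense_open_in_def)
  have "T closure_of (U \<inter> V) = T closure_of (U \<inter> T closure_of V)"
    using assms closure_of_openin_Int_closure_of[of T U V] by (simp add: dense_open_in_def)
  also have "\<dots> = T closure_of U"
    using assms openin_subset by (metis Int_absorb2 dense_open_in_def)
  finally show "T closure_of (U \<inter> V) = topspace T" using assms by (simp add: dense_open_in_def)
qed

section \<open>The algebra of extended continuous functions\<close>

text \<open>
  Functions on the Stone space are represented by functions on all of \<open>'b set\<close> that are
  \<open>undefined\<close> outside the set of ultrafilters (\<open>extensional\<close>), so that equality of
  representatives is equality of functions on the Stone space.
\<close>

definition C_infinity :: "('b::complete_bool_alg set \<Rightarrow> ereal) set" where
  "C_infinity = {x. x \<in> extensional (topspace stone_space) \<and>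
     continuous_map stone_space euclidean x \<and>
     nowhere_dense_in stone_space {q \<in> topspace stone_space. \<bar>x q\<bar> = \<infinity>}}"

lemma const_in_C_infinity:
  "restrict (\<lambda>q. ereal c) (topspace stone_space) \<in> C_infinity"
proof -
  have "continuous_map stone_space euclidean (restrict (\<lambda>q. ereal c) (topspace stone_space))"
    by (rule continuous_map_eq[of _ _ "\<lambda>q. ereal c"]) auto
  then show ?thesis by (auto simp: C_infinity_def nowhere_dense_in_def)
qed

typedef (overloaded) 'b L0 = "C_infinity :: ('b::complete_bool_alg set \<Rightarrow> ereal) set"
  using const_in_C_infinity[of 0] by blast

lemma L0_extensional: "Rep_L0 x \<in> extensional (topspace stone_space)"
  and L0_continuous: "continuous_map stone_space euclidean (Rep_L0 x)"
  and L0_nowhere: "nowhere_dense_in stone_space {q \<in> topspace stone_space. \<bar>Rep_L0 x q\<bar> = \<infinity>}"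
  using Rep_L0[of x] by (auto simp: C_infinity_def)

text \<open>
  The element of \<open>L0\<close> that agrees with \<open>f\<close> on some dense open set; its existence for the
  functions \<open>f\<close> arising from the algebraic operations, and its uniqueness, are shown below.
\<close>

definition dense_ext :: "('b::complete_bool_alg set \<Rightarrow> ereal) \<Rightarrow> 'b L0" where
  "dense_ext f = (THE z. \<exists>U. dense_open_in stone_space U \<and> (\<forall>q\<in>U. Rep_L0 z q = f q))"

definition generically :: "('b::complete_bool_alg set \<Rightarrow> bool) \<Rightarrow> bool" where
  "generically P \<longleftrightarrow> (\<exists>U. dense_open_in stone_space U \<and> (\<forall>q\<in>U. P q))"

lemma generically_conj: "generically P \<Longrightarrow> generically R \<Longrightarrow> generically (\<lambda>q. P q \<and> R q)"
  unfolding generically_def by (blast intro: dense_open_in_Int)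

lemma generically_mono: "generically P \<Longrightarrow> (\<And>q. P q \<Longrightarrow> R q) \<Longrightarrow> generically R"
  unfolding generically_def by blast

lemma Hausdorff_ereal: "Hausdorff_space (euclidean :: ereal topology)"
proof -
  have "\<exists>A B. open A \<and> open B \<and> a \<in> A \<and> b \<in> B \<and> disjnt A B" if "a \<noteq> b" for a b :: ereal
    using hausdorff[OF that] unfolding disjnt_def by blast
  then show ?thesis
    unfolding Hausdorff_space_def by simp
qed

lemma L0_eqI:
  assumes "generically (\<lambda>q. Rep_L0 x q = Rep_L0 y q)"
  shows "x = y"
proof -
  obtain U where U: "dense_open_in stone_space U" "\<And>q. q \<in> U \<Longrightarrow> Rep_L0 x q = Rep_L0 y q"
    using assms unfolding generically_def by blast
  have "Rep_L0 x q = Rep_L0 y q" if "q \<in> topspace stone_space" for q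
  proof (rule forall_in_closure_of_eq[of q stone_space U euclidean "Rep_L0 x" "Rep_L0 y"])
    show "q \<in> stone_space closure_of U" using U(1) that by (simp add: dense_open_in_def)
  qed (use U L0_continuous Hausdorff_ereal in auto)
  then have "Rep_L0 x = Rep_L0 y" by (intro extensionalityI[OF L0_extensional L0_extensional])
  then show ?thesis by (simp add: Rep_L0_inject)
qed

lemma L0_finite: "generically (\<lambda>q. \<bar>Rep_L0 x q\<bar> \<noteq> \<infinity>)"
proof -
  let ?S = "{q \<in> topspace stone_space. Rep_L0 x q \<in> {-\<infinity>, \<infinity>}}"
  have S: "{q \<in> topspace stone_space. \<bar>Rep_L0 x q\<bar> = \<infinity>} = ?S" by auto
  have cl: "closedin stone_space ?S"
    by (rule closedin_continuous_map_preimage[OF L0_continuous]) simp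
  then have "stone_space interior_of ?S = {}"
    using L0_nowhere[of x] unfolding S nowhere_dense_in_def by (simp add: closure_of_closedin)
  then have "dense_open_in stone_space (topspace stone_space - ?S)"
    using cl unfolding dense_open_in_def closure_of_complement by blast
  then show ?thesis unfolding generically_def by (intro exI conjI) auto
qed

lemma continuous_map_ereal_rays:
  fixes z :: "'a \<Rightarrow> ereal"
  assumes "\<And>a. openin T {q \<in> topspace T. z q < a}" "\<And>a. openin T {q \<in> topspace T. a < z q}"
  shows "continuous_map T euclidean z"
proof -
  have "openin T {q \<in> topspace T. z q \<in> V}" if "open V" for V
  proof -
    from that have "generate_topology (range lessThan \<union> range greaterThan) V"
      by (simp add: open_generated_order)
    then show ?thesis
    proof induction
      case UNIV show ?case by simp
    next
      case (Int a b)
      have "{q \<in> topspace T. z q \<in> a \<inter> b} = {q \<in> topspace T. z q \<in> a} \<inter> {q \<in> topspace T. z q \<in> b}"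
        by blast
      with Int show ?case by (simp only: openin_Int)
    next
      case (UN K)
      have "{q \<in> topspace T. z q \<in> \<Union>K} = (\<Union>k\<in>K. {q \<in> topspace T. z q \<in> k})" by blast
      with UN show ?case by (auto intro: openin_Union)
    next
      case (Basis s) with assms show ?case by auto
    qed
  qed
  then show ?thesis by (simp add: continuous_map)
qed

lemma extension_exists:
  fixes f :: "'b::complete_bool_alg set \<Rightarrow> ereal"
  assumes U: "dense_open_in stone_space U"
    and cont: "continuous_map (subtopology stone_space U) euclidean f"
    and fin: "\<And>q. q \<in> U \<Longrightarrow> \<bar>f q\<bar> \<noteq> \<infinity>"
  shows "\<exists>z. \<forall>q\<in>U. Rep_L0 z q = f q"
proof -
  let ?Q = "stone_space :: 'b set topology"
  have oU: "openin ?Q U" and UQ: "U \<subseteq> topspace ?Q"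
    using U openin_subset unfolding dense_open_in_def by blast+
  have pre: "openin ?Q {p \<in> U. f p \<in> V}" if "open V" for V
  proof -
    have "openin (subtopology ?Q U) {p \<in> topspace (subtopology ?Q U). f p \<in> V}"
      using cont that by (intro openin_continuous_map_preimage) auto
    moreover have "{p \<in> topspace (subtopology ?Q U). f p \<in> V} = {p \<in> U. f p \<in> V}"
      using UQ by auto
    ultimately show ?thesis using openin_open_subtopology[OF oU] by metis
  qed
  define C where "C r = ?Q closure_of {p \<in> U. f p > ereal r}" for r
  have oC: "openin ?Q (C r)" for r
    unfolding C_def using pre[of "{ereal r<..}"] by (intro stone_extremally_disconnected) simp
  have cC: "closedin ?Q (C r)" for r unfolding C_def by simp
  have mono: "C r \<subseteq> C s" if "s \<le> r" for r s
    unfolding C_def using that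
    by (intro closure_of_mono) (auto intro: le_less_trans[of "ereal s" "ereal r"])
  define z where "z = (\<lambda>q. SUP r\<in>{r. q \<in> C r}. ereal r)"
  have less: "z q < a \<longleftrightarrow> (\<exists>r. ereal r < a \<and> q \<notin> C r)" for q a
  proof
    assume "z q < a"
    then obtain r where r: "z q < ereal r" "ereal r < a" using ereal_dense2 by blast
    have "q \<notin> C r"
    proof
      assume "q \<in> C r"
      then have "ereal r \<le> z q" unfolding z_def by (intro SUP_upper) simp
      with r(1) show False by simp
    qed
    with r(2) show "\<exists>r. ereal r < a \<and> q \<notin> C r" by blast
  next
    assume "\<exists>r. ereal r < a \<and> q \<notin> C r"
    then obtain r where r: "ereal r < a" "q \<notin> C r" by blast
    have "z q \<le> ereal r" unfolding z_def
    proof (rule SUP_least)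
      fix s assume "s \<in> {s. q \<in> C s}"
      with r(2) mono[of r s] show "ereal s \<le> ereal r" by force
    qed
    with r(1) show "z q < a" by simp
  qed
  have gr: "a < z q \<longleftrightarrow> (\<exists>r. a < ereal r \<and> q \<in> C r)" for q a
    unfolding z_def by (auto simp: less_SUP_iff)
  have cz: "continuous_map ?Q euclidean z"
  proof (rule continuous_map_ereal_rays)
    fix a
    have "{q \<in> topspace ?Q. z q < a} = (\<Union>r\<in>{r. ereal r < a}. topspace ?Q - C r)"
      using less by auto
    moreover have "openin ?Q (\<Union>r\<in>{r. ereal r < a}. topspace ?Q - C r)"
      using cC unfolding closedin_def by (intro openin_Union) blast
    ultimately show "openin ?Q {q \<in> topspace ?Q. z q < a}" by (simp only:)
    have "{q \<in> topspace ?Q. a < z q} = (\<Union>r\<in>{r. a < ereal r}. C r)"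
      using gr openin_subset[OF oC] by blast
    then show "openin ?Q {q \<in> topspace ?Q. a < z q}"
      using oC by (auto intro!: openin_Union)
  qed
  have zf: "z q = f q" if q: "q \<in> U" for q
  proof (rule antisym)
    show "z q \<le> f q" unfolding z_def
    proof (rule SUP_least)
      fix r assume "r \<in> {r. q \<in> C r}"
      then have r: "q \<in> C r" by simp
      show "ereal r \<le> f q"
      proof (rule ccontr)
        assume "\<not> ?thesis"
        then have 1: "q \<in> {p \<in> U. f p \<in> {..<ereal r}}" using q by simp
        have 2: "openin ?Q {p \<in> U. f p \<in> {..<ereal r}}" by (rule pre) simp
        have "\<And>T. q \<in> T \<Longrightarrow> openin ?Q T \<Longrightarrow> \<exists>y. y \<in> {p \<in> U. f p > ereal r} \<and> y \<in> T"
          using r unfolding C_def in_closure_of by (elim conjE allE impE) auto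
        from this[OF 1 2] show False by auto
      qed
    qed
    show "f q \<le> z q"
    proof (rule ccontr)
      assume "\<not> ?thesis"
      then have "z q < f q" by simp
      from ereal_dense2[OF this] obtain r where r: "z q < ereal r" "ereal r < f q"
        by (elim exE conjE)
      then have "q \<in> {p \<in> U. f p > ereal r}" using q by simp
      moreover have "{p \<in> U. f p > ereal r} \<subseteq> C r"
        unfolding C_def using UQ by (intro closure_of_subset) auto
      ultimately have "ereal r \<le> z q" unfolding z_def by (intro SUP_upper) auto
      with r(1) show False by simp
    qed
  qed
  define w where "w = restrict z (topspace ?Q)"
  have wU: "w q = f q" if "q \<in> U" for q using that zf UQ unfolding w_def by auto
  have cw: "continuous_map ?Q euclidean w"
    by (rule continuous_map_eq[OF cz]) (simp add: w_def)
  let ?S = "{q \<in> topspace ?Q. \<bar>w q\<bar> = \<infinity>}"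
  have "?S = {q \<in> topspace ?Q. w q \<in> {-\<infinity>, \<infinity>}}" by auto
  then have "closedin ?Q ?S"
    using closedin_continuous_map_preimage[OF cw, of "{-\<infinity>, \<infinity>}"] by simp
  then have "?Q closure_of ?S = ?S" by (rule closure_of_closedin)
  moreover have "?Q interior_of ?S = {}"
  proof (rule ccontr)
    assume "?Q interior_of ?S \<noteq> {}"
    moreover have "\<forall>T. openin ?Q T \<and> T \<noteq> {} \<longrightarrow> U \<inter> T \<noteq> {}"
      using U unfolding dense_open_in_def dense_intersects_open by blast
    ultimately have "U \<inter> ?Q interior_of ?S \<noteq> {}" by simp
    then obtain q where q: "q \<in> U" "q \<in> ?Q interior_of ?S" by blast
    have "q \<in> ?S" using q(2) by (rule subsetD[OF interior_of_subset])
    then show False using wU[OF q(1)] fin[OF q(1)] by simp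
  qed
  ultimately have "w \<in> C_infinity"
    unfolding C_infinity_def nowhere_dense_in_def using cw by (simp add: w_def)
  then have "Rep_L0 (Abs_L0 w) = w" by (rule Abs_L0_inverse)
  with wU show ?thesis by (intro exI[of _ "Abs_L0 w"]) simp
qed

lemma Rep_dense_ext:
  assumes "generically (\<lambda>q. Rep_L0 z q = f q)"
  shows "dense_ext f = z"
  unfolding dense_ext_def
proof (rule the_equality)
  show "\<exists>U. dense_open_in stone_space U \<and> (\<forall>q\<in>U. Rep_L0 z q = f q)"
    using assms unfolding generically_def .
next
  fix y assume "\<exists>U. dense_open_in stone_space U \<and> (\<forall>q\<in>U. Rep_L0 y q = f q)"
  then have "generically (\<lambda>q. Rep_L0 y q = f q)" unfolding generically_def .
  from generically_conj[OF this assms] show "y = z"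
    by (intro L0_eqI) (erule generically_mono, simp)
qed

lemma dense_ext_generic:
  fixes f :: "'b::complete_bool_alg set \<Rightarrow> ereal"
  assumes U: "dense_open_in stone_space U"
    and g: "continuous_map (subtopology stone_space U) euclideanreal g"
    and f: "\<And>q. q \<in> U \<Longrightarrow> f q = ereal (g q)"
  shows "generically (\<lambda>q. Rep_L0 (dense_ext f) q = f q)"
proof -
  have "continuous_map (subtopology stone_space U) euclidean (ereal \<circ> g)"
    by (rule continuous_map_compose[OF g]) (auto intro: continuous_intros)
  then have "continuous_map (subtopology stone_space U) euclidean f"
    by (rule continuous_map_eq) (auto simp: f)
  then have "\<exists>z. \<forall>q\<in>U. Rep_L0 z q = f q" by (rule extension_exists[OF U]) (simp add: f)
  then obtain z where "\<forall>q\<in>U. Rep_L0 z q = f q" by (elim exE)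
  then have z: "generically (\<lambda>q. Rep_L0 z q = f q)" unfolding generically_def using U by (intro exI conjI)
  with Rep_dense_ext[OF z] show ?thesis by simp
qed

definition real_part :: "'b::complete_bool_alg L0 \<Rightarrow> 'b set \<Rightarrow> real" where
  "real_part x q = real_of_ereal (Rep_L0 x q)"

lemma real_part_generic: "generically (\<lambda>q. Rep_L0 x q = ereal (real_part x q))"
  using L0_finite[of x] by (rule generically_mono) (auto simp: real_part_def ereal_real)

lemma real_part_continuous:
  "\<exists>U. dense_open_in stone_space U \<and>
     continuous_map (subtopology stone_space U) euclideanreal (real_part x) \<and>
     (\<forall>q\<in>U. Rep_L0 x q = ereal (real_part x q))"
proof -
  obtain U where U: "dense_open_in stone_space U" "\<forall>q\<in>U. \<bar>Rep_L0 x q\<bar> \<noteq> \<infinity>"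
    using L0_finite[of x] unfolding generically_def by (elim exE conjE)
  let ?T = "subtopology stone_space U"
  have "continuous_map ?T (top_of_set (UNIV - {\<infinity>, -\<infinity>})) (Rep_L0 x)"
    unfolding continuous_map_in_subtopology
    using U(2) by (auto intro!: continuous_map_from_subtopology L0_continuous)
  then have "continuous_map ?T euclideanreal (real_of_ereal \<circ> Rep_L0 x)"
    by (rule continuous_map_compose) (simp add: continuous_on_real)
  then have "continuous_map ?T euclideanreal (real_part x)"
    by (simp add: real_part_def[abs_def] o_def)
  with U show ?thesis by (intro exI conjI) (auto simp: real_part_def ereal_real)
qed

lemma L0_binop_generic:
  fixes x y :: "'b::complete_bool_alg L0"
  assumes cont: "\<And>T g h. continuous_map T euclideanreal g \<Longrightarrow> continuous_map T euclideanreal h \<Longrightarrow>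
      continuous_map T euclideanreal (\<lambda>q :: 'b set. op_r (g q) (h q))"
    and e: "\<And>a b. op_e (ereal a) (ereal b) = ereal (op_r a b)"
  shows "generically (\<lambda>q. Rep_L0 (dense_ext (\<lambda>q. op_e (Rep_L0 x q) (Rep_L0 y q))) q
      = ereal (op_r (real_part x q) (real_part y q)))"
proof -
  obtain U where U: "dense_open_in stone_space U"
     "continuous_map (subtopology stone_space U) euclideanreal (real_part x)"
     "\<And>q. q \<in> U \<Longrightarrow> Rep_L0 x q = ereal (real_part x q)"
    using real_part_continuous[of x] by blast
  obtain V where V: "dense_open_in stone_space V"
     "continuous_map (subtopology stone_space V) euclideanreal (real_part y)"
     "\<And>q. q \<in> V \<Longrightarrow> Rep_L0 y q = ereal (real_part y q)"
    using real_part_continuous[of y] by blast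
  have 1: "continuous_map (subtopology stone_space (U \<inter> V)) euclideanreal
      (\<lambda>q. op_r (real_part x q) (real_part y q))"
    by (intro cont continuous_map_from_subtopology_mono[OF U(2)]
          continuous_map_from_subtopology_mono[OF V(2)]) auto
  have "generically (\<lambda>q. Rep_L0 (dense_ext (\<lambda>q. op_e (Rep_L0 x q) (Rep_L0 y q))) q
      = op_e (Rep_L0 x q) (Rep_L0 y q))"
    by (rule dense_ext_generic[OF dense_open_in_Int[OF U(1) V(1)] 1]) (simp add: U(3) V(3) e)
  from generically_conj[OF this generically_conj[OF real_part_generic[of x] real_part_generic[of y]]]
  show ?thesis by (rule generically_mono) (simp add: e)
qed

lemma L0_eqI_real:
  assumes "generically (\<lambda>q. real_part x q = real_part y q)"
  shows "x = y"
  using generically_conj[OF assms generically_conj[OF real_part_generic[of x] real_part_generic[of y]]]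
  by (intro L0_eqI) (erule generically_mono, simp)

instantiation L0 :: (complete_bool_alg) "{comm_ring, real_algebra, order, abs}"
begin

definition zero_L0 :: "'a L0" where
  "0 = dense_ext (\<lambda>q. 0)"

definition plus_L0 :: "'a L0 \<Rightarrow> 'a L0 \<Rightarrow> 'a L0" where
  "x + y = dense_ext (\<lambda>q. Rep_L0 x q + Rep_L0 y q)"

definition minus_L0 :: "'a L0 \<Rightarrow> 'a L0 \<Rightarrow> 'a L0" where
  "x - y = dense_ext (\<lambda>q. Rep_L0 x q - Rep_L0 y q)"

definition uminus_L0 :: "'a L0 \<Rightarrow> 'a L0" where
  "- x = dense_ext (\<lambda>q. - Rep_L0 x q)"

definition times_L0 :: "'a L0 \<Rightarrow> 'a L0 \<Rightarrow> 'a L0" where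
  "x * y = dense_ext (\<lambda>q. Rep_L0 x q * Rep_L0 y q)"

definition scaleR_L0 :: "real \<Rightarrow> 'a L0 \<Rightarrow> 'a L0" where
  "c *\<^sub>R x = dense_ext (\<lambda>q. ereal c * Rep_L0 x q)"

definition abs_L0 :: "'a L0 \<Rightarrow> 'a L0" where
  "\<bar>x\<bar> = dense_ext (\<lambda>q. \<bar>Rep_L0 x q\<bar>)"

definition less_eq_L0 :: "'a L0 \<Rightarrow> 'a L0 \<Rightarrow> bool" where
  "x \<le> y \<longleftrightarrow> (\<forall>q\<in>topspace stone_space. Rep_L0 x q \<le> Rep_L0 y q)"

definition less_L0 :: "'a L0 \<Rightarrow> 'a L0 \<Rightarrow> bool" where
  "x < y \<longleftrightarrow> x \<le> y \<and> \<not> y \<le> x" for x y :: "'a L0"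

lemma Rep_generic_real: "generically (\<lambda>q. Rep_L0 x q = ereal (f q)) \<Longrightarrow> generically (\<lambda>q. real_part x q = f q)"
  by (erule generically_mono) (simp add: real_part_def)

lemma real_part_zero: "generically (\<lambda>q. real_part (0 :: 'a L0) q = 0)"
  unfolding zero_L0_def
  by (rule Rep_generic_real, unfold zero_ereal_def[symmetric],
      rule dense_ext_generic[where U = "topspace stone_space" and g = "\<lambda>_. 0"])
    (auto simp: dense_open_in_def)

lemma real_part_plus: "generically (\<lambda>q. real_part (x + y :: 'a L0) q = real_part x q + real_part y q)"
  unfolding plus_L0_def
  by (rule Rep_generic_real, rule L0_binop_generic[where op_r = "(+)"])
    (auto intro: continuous_map_add)

lemma real_part_minus: "generically (\<lambda>q. real_part (x - y :: 'a L0) q = real_part x q - real_part y q)"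
  unfolding minus_L0_def
  by (rule Rep_generic_real, rule L0_binop_generic[where op_r = "(-)"])
    (auto intro: continuous_map_diff)

lemma real_part_times: "generically (\<lambda>q. real_part (x * y :: 'a L0) q = real_part x q * real_part y q)"
  unfolding times_L0_def
  by (rule Rep_generic_real, rule L0_binop_generic[where op_r = "(*)"])
    (auto intro: continuous_map_real_mult)

lemma real_part_uminus: "generically (\<lambda>q. real_part (- x :: 'a L0) q = - real_part x q)"
  unfolding uminus_L0_def
  by (rule Rep_generic_real, rule L0_binop_generic[where op_r = "\<lambda>a b. - a" and op_e = "\<lambda>a b. - a" and y = x])
    (auto intro: continuous_map_minus)

lemma real_part_scaleR: "generically (\<lambda>q. real_part (c *\<^sub>R x :: 'a L0) q = c * real_part x q)"
  unfolding scaleR_L0_def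
  by (rule Rep_generic_real,
      rule L0_binop_generic[where op_r = "\<lambda>a b. c * a" and op_e = "\<lambda>a b. ereal c * a" and y = x])
    (auto intro: continuous_map_real_mult_left)

lemma Rep_abs_generic: "generically (\<lambda>q. Rep_L0 (\<bar>x\<bar> :: 'a L0) q = ereal \<bar>real_part x q\<bar>)"
  unfolding abs_L0_def
  by (rule L0_binop_generic[where op_r = "\<lambda>a b. \<bar>a\<bar>" and op_e = "\<lambda>a b. \<bar>a\<bar>" and y = x])
    (auto intro: continuous_map_real_abs)

lemmas real_part_ops = real_part_zero real_part_plus real_part_minus real_part_times
  real_part_uminus real_part_scaleR

instance
proof
  fix x y z :: "'a L0" and a b :: real
  note G = generically_conj
  show "x + y + z = x + (y + z)"
    using G[OF G[OF real_part_plus[of "x + y" z] real_part_plus[of x y]]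
        G[OF real_part_plus[of x "y + z"] real_part_plus[of y z]]]
    by (intro L0_eqI_real) (erule generically_mono, simp)
  show "x + y = y + x"
    using G[OF real_part_plus[of x y] real_part_plus[of y x]]
    by (intro L0_eqI_real) (erule generically_mono, simp)
  show "0 + x = x"
    using G[OF real_part_plus[of 0 x] real_part_zero]
    by (intro L0_eqI_real) (erule generically_mono, simp)
  show "- x + x = 0"
    using G[OF G[OF real_part_plus[of "- x" x] real_part_uminus[of x]] real_part_zero]
    by (intro L0_eqI_real) (erule generically_mono, simp)
  show "x - y = x + - y"
    using G[OF G[OF real_part_plus[of x "- y"] real_part_uminus[of y]] real_part_minus[of x y]]
    by (intro L0_eqI_real) (erule generically_mono, simp)
  show "x * y * z = x * (y * z)"
    using G[OF G[OF real_part_times[of "x * y" z] real_part_times[of x y]]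
        G[OF real_part_times[of x "y * z"] real_part_times[of y z]]]
    by (intro L0_eqI_real) (erule generically_mono, simp)
  show "x * y = y * x"
    using G[OF real_part_times[of x y] real_part_times[of y x]]
    by (intro L0_eqI_real) (erule generically_mono, simp)
  show "(x + y) * z = x * z + y * z"
    using G[OF G[OF real_part_times[of "x + y" z] real_part_plus[of x y]]
        G[OF real_part_plus[of "x * z" "y * z"] G[OF real_part_times[of x z] real_part_times[of y z]]]]
    by (intro L0_eqI_real) (erule generically_mono, simp add: algebra_simps)
  show "x * (y + z) = x * y + x * z"
    using G[OF G[OF real_part_times[of x "y + z"] real_part_plus[of y z]]
        G[OF real_part_plus[of "x * y" "x * z"] G[OF real_part_times[of x y] real_part_times[of x z]]]]
    by (intro L0_eqI_real) (erule generically_mono, simp add: algebra_simps)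
  show "a *\<^sub>R (x + y) = a *\<^sub>R x + a *\<^sub>R y"
    using G[OF G[OF real_part_scaleR[of a "x + y"] real_part_plus[of x y]]
        G[OF real_part_plus[of "a *\<^sub>R x" "a *\<^sub>R y"] G[OF real_part_scaleR[of a x] real_part_scaleR[of a y]]]]
    by (intro L0_eqI_real) (erule generically_mono, simp add: algebra_simps)
  show "(a + b) *\<^sub>R x = a *\<^sub>R x + b *\<^sub>R x"
    using G[OF real_part_scaleR[of "a + b" x]
        G[OF real_part_plus[of "a *\<^sub>R x" "b *\<^sub>R x"] G[OF real_part_scaleR[of a x] real_part_scaleR[of b x]]]]
    by (intro L0_eqI_real) (erule generically_mono, simp add: algebra_simps)
  show "a *\<^sub>R b *\<^sub>R x = (a * b) *\<^sub>R x"
    using G[OF real_part_scaleR[of "a * b" x] G[OF real_part_scaleR[of a "b *\<^sub>R x"] real_part_scaleR[of b x]]]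
    by (intro L0_eqI_real) (erule generically_mono, simp)
  show "1 *\<^sub>R x = x"
    using real_part_scaleR[of 1 x] by (intro L0_eqI_real) simp
  show "a *\<^sub>R x * y = a *\<^sub>R (x * y)"
    using G[OF G[OF real_part_times[of "a *\<^sub>R x" y] real_part_scaleR[of a x]]
        G[OF real_part_scaleR[of a "x * y"] real_part_times[of x y]]]
    by (intro L0_eqI_real) (erule generically_mono, simp)
  show "x * a *\<^sub>R y = a *\<^sub>R (x * y)"
    using G[OF G[OF real_part_times[of x "a *\<^sub>R y"] real_part_scaleR[of a y]]
        G[OF real_part_scaleR[of a "x * y"] real_part_times[of x y]]]
    by (intro L0_eqI_real) (erule generically_mono, simp)
  show "x < y \<longleftrightarrow> x \<le> y \<and> \<not> y \<le> x" by (rule less_L0_def)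
  show "x \<le> x" by (simp add: less_eq_L0_def)
  show "x \<le> y \<Longrightarrow> y \<le> z \<Longrightarrow> x \<le> z" unfolding less_eq_L0_def by (meson order_trans)
  show "x \<le> y \<Longrightarrow> y \<le> x \<Longrightarrow> x = y"
    unfolding less_eq_L0_def
    by (subst Rep_L0_inject[symmetric])
      (intro extensionalityI[OF L0_extensional L0_extensional] antisym, auto)
qed

end

text \<open>The modulus is the pointwise one, hence the lattice modulus for the pointwise order.\<close>

lemma Rep_abs_L0:
  assumes "q \<in> topspace stone_space"
  shows "Rep_L0 \<bar>x\<bar> q = \<bar>Rep_L0 x q\<bar>"
proof -
  have "generically (\<lambda>q. Rep_L0 \<bar>x\<bar> q = \<bar>Rep_L0 x q\<bar>)"
    using generically_conj[OF Rep_abs_generic[of x] real_part_generic[of x]]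
    by (rule generically_mono) simp
  then obtain U where U: "dense_open_in stone_space U" "\<And>q. q \<in> U \<Longrightarrow> Rep_L0 \<bar>x\<bar> q = \<bar>Rep_L0 x q\<bar>"
    unfolding generically_def by blast
  have "continuous_map euclidean euclidean (abs :: ereal \<Rightarrow> ereal)"
    using continuous_ereal_abs by simp
  then have "continuous_map stone_space euclidean (abs \<circ> Rep_L0 x)"
    by (rule continuous_map_compose[OF L0_continuous])
  then show ?thesis
    using forall_in_closure_of_eq[of q stone_space U euclidean "Rep_L0 \<bar>x\<bar>" "abs \<circ> Rep_L0 x"]
      U L0_continuous Hausdorff_ereal assms by (auto simp: dense_open_in_def)
qed

text \<open>The characteristic function of the clopen set belonging to \<open>b\<close>.\<close>

definition idempotent_of :: "'b::complete_bool_alg \<Rightarrow> 'b L0" where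
  "idempotent_of b = Abs_L0 (restrict (indicator (stone_clopen b)) (topspace stone_space))"

lemma Rep_idem: "Rep_L0 (idempotent_of b) = restrict (indicator (stone_clopen b)) (topspace stone_space)"
proof -
  let ?f = "restrict (indicator (stone_clopen b)) (topspace stone_space) :: _ \<Rightarrow> ereal"
  have "openin stone_space {q \<in> topspace stone_space. ?f q \<in> V}" for V
  proof -
    have "{q \<in> topspace stone_space. ?f q \<in> V} =
       (if 1 \<in> V then stone_clopen b else {}) \<union> (if 0 \<in> V then stone_clopen (- b) else {})"
      using openin_subset[OF openin_stone_clopen[of b]]
      by (auto simp: stone_clopen_compl indicator_def)
    then show ?thesis by (auto simp: openin_stone_clopen)
  qed
  then have "continuous_map stone_space euclidean ?f" by (simp add: continuous_map)
  moreover have "{q \<in> topspace stone_space. \<bar>?f q\<bar> = \<infinity>} = {}"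
    by (auto simp: indicator_def)
  ultimately have "?f \<in> C_infinity" by (simp add: C_infinity_def nowhere_dense_in_def)
  then show ?thesis unfolding idempotent_of_def by (rule Abs_L0_inverse)
qed

definition C_Q :: "'b::complete_bool_alg L0 set" where
  "C_Q = {x. \<forall>q\<in>topspace stone_space. \<bar>Rep_L0 x q\<bar> \<noteq> \<infinity>}"

text \<open>
  An element \<open>b\<close> of the algebra is identified with the idempotent \<open>idempotent_of b\<close>; accordingly
  the supremum and the difference are taken in the algebra, where \<open>top\<close> is the unit.
\<close>

definition support :: "'b::complete_bool_alg L0 \<Rightarrow> 'b" where
  "support x = top - Sup {e. idempotent_of e * x = 0}"

section \<open>Quasi-normed solid spaces and derivations\<close>

definition solid_space :: "'b::complete_bool_alg L0 set \<Rightarrow> bool" where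
  "solid_space Y \<longleftrightarrow> subspace Y \<and> Y \<noteq> {0} \<and> (\<forall>x\<in>Y. \<forall>y. \<bar>y\<bar> \<le> \<bar>x\<bar> \<longrightarrow> y \<in> Y)"

definition quasi_norm_on :: "'v::real_vector set \<Rightarrow> ('v \<Rightarrow> real) \<Rightarrow> bool" where
  "quasi_norm_on Y N \<longleftrightarrow> (\<exists>C\<ge>1.
     (\<forall>x\<in>Y. N x \<ge> 0 \<and> (N x = 0 \<longleftrightarrow> x = 0)) \<and>
     (\<forall>x\<in>Y. \<forall>a. N (a *\<^sub>R x) = \<bar>a\<bar> * N x) \<and>
     (\<forall>x\<in>Y. \<forall>y\<in>Y. N (x + y) \<le> C * (N x + N y)))"

definition quasi_normed_solid_space :: "'b::complete_bool_alg L0 set \<Rightarrow> ('b L0 \<Rightarrow> real) \<Rightarrow> bool" where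
  "quasi_normed_solid_space Y N \<longleftrightarrow> solid_space Y \<and> quasi_norm_on Y N \<and>
     (\<forall>x\<in>Y. \<forall>y\<in>Y. \<bar>y\<bar> \<le> \<bar>x\<bar> \<longrightarrow> N y \<le> N x)"

definition ideal_in_C_Q :: "'b::complete_bool_alg L0 set \<Rightarrow> bool" where
  "ideal_in_C_Q X \<longleftrightarrow> X \<subseteq> C_Q \<and> subspace X \<and> (\<forall>a\<in>X. \<forall>b\<in>X. a * b \<in> X) \<and>
     (\<forall>x\<in>C_Q. \<forall>a\<in>X. x * a \<in> X)"

text \<open>A map from \<open>X\<close> to \<open>Y\<close> is a function on the whole type of which only the values on \<open>X\<close> matter.\<close>

definition derivation_on ::
  "'b::complete_bool_alg L0 set \<Rightarrow> 'b L0 set \<Rightarrow> ('b L0 \<Rightarrow> 'b L0) \<Rightarrow> bool" where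
  "derivation_on X Y d \<longleftrightarrow> d ` X \<subseteq> Y \<and>
     (\<forall>x\<in>X. \<forall>y\<in>X. d (x + y) = d x + d y) \<and>
     (\<forall>a. \<forall>x\<in>X. d (a *\<^sub>R x) = a *\<^sub>R d x) \<and>
     (\<forall>x\<in>X. \<forall>y\<in>X. d (x * y) = d x * y + x * d y)"

definition band_preserving_on ::
  "'b::complete_bool_alg L0 set \<Rightarrow> ('b L0 \<Rightarrow> 'b L0) \<Rightarrow> bool" where
  "band_preserving_on X d \<longleftrightarrow> (\<forall>x\<in>X. support (d x) \<le> support x)"

end

theory Submission
  imports Defs
begin

text \<open>
  Suppose \<open>\<delta> a \<noteq> 0\<close>. A band preserving derivation commutes with multiplication by idempotents,
  so it treats real scalars that vary from one clopen set to another as constants: if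
  \<open>w = k a - t\<close> on a clopen set with real \<open>k\<close> and \<open>t\<close>, then \<open>\<delta> (w a) = k a \<delta> a + w \<delta> a\<close> there
  (lemma \<open>d_affine\<close>). Here \<open>w\<close> can be bounded by \<open>1\<close> although \<open>k\<close> is arbitrarily large: the
  fractional part of \<open>k a\<close> has this form near each point of a dense open set, and extremal disconnectedness of
  the Stone space extends it to a continuous function. Up to the bounded error
  \<open>w \<delta> a\<close>, the derivation thus maps the bounded multiple \<open>w a\<close> of \<open>a\<close> to an arbitrarily large
  multiple of \<open>u = a \<delta> a\<close>.

  To contradict the existence of a quasi-norm, different factors are used on infinitely many disjoint
  pieces. First, \<open>u \<noteq> 0\<close>, because \<open>\<delta> a\<close> lives inside the support of \<open>a\<close> (\<open>mult_d_nonzero\<close>).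
  There is no atom under the support of \<open>u\<close>: on an atom \<open>a\<close> is constant, and \<open>d_affine\<close> with
  \<open>w = 0\<close> and \<open>k = 1\<close> gives \<open>u = 0\<close> there (\<open>mult_d_zero_on_atom\<close>). Hence that support contains
  a sequence of disjoint non-zero \<open>e n\<close>. With \<open>k n\<close> chosen so that \<open>k n (e n) u\<close> has norm \<open>n\<close>, one
  bounded \<open>w\<close> serves all \<open>e n\<close> at once (\<open>d_amplified\<close>), so that \<open>k n (e n) u\<close> is the difference of
  \<open>(e n) \<delta> (w a)\<close> and \<open>(e n) w \<delta> a\<close>. Monotonicity and the quasi-triangle inequality with constant
  \<open>C\<close> bound its norm by \<open>C (N (\<delta> (w a)) + N (\<delta> a))\<close>, independently of \<open>n\<close>, which is absurd.
\<close>

section \<open>Pointwise reasoning in the algebra of extended functions\<close>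

lemma stone_space_generic: "generically (\<lambda>q. q \<in> topspace stone_space)"
  unfolding generically_def by (auto simp: dense_open_in_def)

lemma dense_open_stoneI:
  fixes U :: "'b::complete_bool_alg set set"
  assumes "openin stone_space U"
    and "\<And>b. b \<noteq> bot \<Longrightarrow> stone_clopen b \<inter> U \<noteq> {}"
  shows "dense_open_in stone_space U"
proof -
  have "U \<inter> T \<noteq> {}" if T: "openin stone_space T" "T \<noteq> {}" for T
  proof -
    obtain F where "F \<in> T" using T by blast
    then obtain b where b: "F \<in> stone_clopen b" "stone_clopen b \<subseteq> T"
      using stone_base[OF T(1)] by blast
    then have "b \<noteq> bot" using stone_clopen_eq_empty by blast
    with assms(2) b(2) show ?thesis by blast
  qed
  then show ?thesis
    using assms(1) unfolding dense_open_in_def dense_intersects_open by blast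
qed

lemma stone_clopen_Int_closure:
  assumes "dense_open_in stone_space U"
  shows "stone_clopen c \<subseteq> stone_space closure_of (U \<inter> stone_clopen c)"
proof -
  have sub: "stone_clopen c \<subseteq> topspace stone_space"
    using openin_stone_clopen by (rule openin_subset)
  have "stone_space closure_of (stone_clopen c \<inter> U)
      = stone_space closure_of (stone_clopen c \<inter> stone_space closure_of U)"
    using closure_of_openin_Int_closure_of[OF openin_stone_clopen] by metis
  also have "\<dots> = stone_space closure_of (stone_clopen c)"
    using assms sub by (simp add: dense_open_in_def Int_absorb2)
  finally show ?thesis
    using closure_of_subset[OF sub] by (simp add: Int_commute)
qed

text \<open>
  The supremum in the algebra may be larger than the union of the clopen sets, but it adds only
  limit points. Continuous functions therefore cannot distinguish the two, which is why the
  supremum in the definition of the support is attained.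
\<close>

lemma stone_clopen_Sup_subset:
  fixes S :: "'b::complete_bool_alg set"
  shows "stone_clopen (Sup S) \<subseteq> stone_space closure_of (\<Union>b\<in>S. stone_clopen b)"
proof
  let ?W = "\<Union>b\<in>S. stone_clopen b"
  fix F assume F: "F \<in> stone_clopen (Sup S)"
  have "\<exists>y. y \<in> ?W \<and> y \<in> T" if T: "F \<in> T" "openin stone_space T" for T
  proof (rule ccontr)
    assume disj: "\<not> ?thesis"
    obtain c where c: "F \<in> stone_clopen c" "stone_clopen c \<subseteq> T"
      using stone_base[OF T(2,1)] by blast
    have "b \<le> - c" if "b \<in> S" for b
    proof -
      have "stone_clopen (inf b c) = {}"
        using that c(2) disj by (auto simp: stone_clopen_inf)
      then show ?thesis by (simp add: stone_clopen_eq_empty inf_shunt)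
    qed
    then have "Sup S \<le> - c" by (rule Sup_least)
    moreover have "ultrafilter F" "Sup S \<in> F" "c \<in> F"
      using F c(1) by (simp_all add: stone_clopen_def)
    ultimately show False
      using ultrafilterD(4)[of F "Sup S" "- c"] ultrafilter_compl[of F c] by simp
  qed
  with F show "F \<in> stone_space closure_of ?W"
    by (auto simp: in_closure_of stone_clopen_def topspace_stone)
qed

lemma real_part_idempotent_generic:
  "generically (\<lambda>q. real_part (idempotent_of c) q = indicator (stone_clopen c) q)"
  using stone_space_generic
  by (rule generically_mono) (simp add: real_part_def Rep_idem indicator_def)

text \<open>
  Zero is given by a definite description, which determines its values only generically; the
  idempotent of \<open>bot\<close> is an explicit representative.
\<close>

lemma Rep_zero_L0:
  assumes "q \<in> topspace stone_space"
  shows "Rep_L0 (0 :: 'b::complete_bool_alg L0) q = 0"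
proof -
  have "idempotent_of bot = (0 :: 'b L0)"
    using generically_conj[OF real_part_zero real_part_idempotent_generic[of "bot :: 'b"]]
    by (intro L0_eqI_real) (erule generically_mono, simp add: stone_clopen_eq_empty[THEN iffD2])
  then show ?thesis
    using Rep_idem[of "bot :: 'b"] assms by (simp add: stone_clopen_eq_empty[THEN iffD2])
qed

lemma Rep_eq_on_closure:
  assumes "q \<in> stone_space closure_of V" "\<And>p. p \<in> V \<Longrightarrow> Rep_L0 x p = Rep_L0 y p"
  shows "Rep_L0 x q = Rep_L0 y q"
  by (rule forall_in_closure_of_eq[OF assms(1) Hausdorff_ereal L0_continuous L0_continuous])
    (rule assms(2))

text \<open>
  Equations that are localised by an idempotent may be checked at every single point of the
  clopen set, the points with infinite values included; this lets algebraic identities be glued.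
\<close>

lemma idempotent_mult_eq_iff:
  "idempotent_of c * x = idempotent_of c * y \<longleftrightarrow> (\<forall>q\<in>stone_clopen c. Rep_L0 x q = Rep_L0 y q)"
proof
  assume eq: "idempotent_of c * x = idempotent_of c * y"
  have "generically (\<lambda>q. q \<in> stone_clopen c \<longrightarrow> Rep_L0 x q = Rep_L0 y q)"
    using generically_conj[OF generically_conj[OF real_part_times[of "idempotent_of c" x]
          real_part_times[of "idempotent_of c" y]]
        generically_conj[OF real_part_idempotent_generic[of c]
          generically_conj[OF real_part_generic[of x] real_part_generic[of y]]]]
    by (rule generically_mono) (auto simp: eq)
  then obtain U where U: "dense_open_in stone_space U"
    "\<And>q. q \<in> U \<Longrightarrow> q \<in> stone_clopen c \<Longrightarrow> Rep_L0 x q = Rep_L0 y q"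
    unfolding generically_def by blast
  show "\<forall>q\<in>stone_clopen c. Rep_L0 x q = Rep_L0 y q"
  proof
    fix q assume "q \<in> stone_clopen c"
    then have "q \<in> stone_space closure_of (U \<inter> stone_clopen c)"
      using stone_clopen_Int_closure[OF U(1)] by blast
    then show "Rep_L0 x q = Rep_L0 y q" by (rule Rep_eq_on_closure) (use U(2) in blast)
  qed
next
  assume eq: "\<forall>q\<in>stone_clopen c. Rep_L0 x q = Rep_L0 y q"
  show "idempotent_of c * x = idempotent_of c * y"
    using generically_conj[OF generically_conj[OF real_part_times[of "idempotent_of c" x]
          real_part_times[of "idempotent_of c" y]] real_part_idempotent_generic[of c]]
    by (intro L0_eqI_real) (erule generically_mono,
       use eq in \<open>auto simp: indicator_def real_part_def\<close>)
qed

lemma idempotent_mult_eq_0_iff: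
  "idempotent_of c * x = 0 \<longleftrightarrow> (\<forall>q\<in>stone_clopen c. Rep_L0 x q = 0)"
  using idempotent_mult_eq_iff[of c x 0] openin_subset[OF openin_stone_clopen[of c]]
  by (auto simp: Rep_zero_L0 subset_iff)

lemma idempotent_mult_compl: "idempotent_of c * x + idempotent_of (- c) * x = x"
  using generically_conj[OF generically_conj[OF real_part_times[of "idempotent_of c" x]
        real_part_times[of "idempotent_of (- c)" x]]
      generically_conj[OF generically_conj[OF real_part_idempotent_generic[of c]
          real_part_idempotent_generic[of "- c"]] generically_conj[OF stone_space_generic
        real_part_plus[of "idempotent_of c * x" "idempotent_of (- c) * x"]]]]
  by (intro L0_eqI_real) (erule generically_mono,
     auto simp: indicator_def stone_clopen_compl)

lemma idempotent_of_inf: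
  "idempotent_of (inf b c) = idempotent_of b * idempotent_of c"
  using generically_conj[OF real_part_times[of "idempotent_of b" "idempotent_of c"]
      generically_conj[OF real_part_idempotent_generic[of "inf b c"]
        generically_conj[OF real_part_idempotent_generic[of b] real_part_idempotent_generic[of c]]]]
  by (intro L0_eqI_real) (erule generically_mono, auto simp: indicator_def stone_clopen_inf)

lemma idempotent_bot_mult: "idempotent_of bot * x = 0"
  by (simp add: idempotent_mult_eq_0_iff stone_clopen_eq_empty[THEN iffD2])

lemma idempotent_mult_disjoint:
  "inf b c = bot \<Longrightarrow> idempotent_of b * (idempotent_of c * x) = 0"
  by (simp add: mult.assoc[symmetric] idempotent_of_inf[symmetric] idempotent_bot_mult)

lemma idempotent_mult_affineI:
  assumes "\<And>q. q \<in> stone_clopen c \<Longrightarrow> real_part w q = k * real_part z q - t"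
  shows "idempotent_of c * w = k *\<^sub>R (idempotent_of c * z) - t *\<^sub>R idempotent_of c"
proof (rule L0_eqI_real)
  let ?c = "idempotent_of c"
  show "generically (\<lambda>q. real_part (?c * w) q = real_part (k *\<^sub>R (?c * z) - t *\<^sub>R ?c) q)"
    using generically_conj[OF generically_conj[OF real_part_times[of ?c w] real_part_times[of ?c z]]
        generically_conj[OF generically_conj[OF real_part_scaleR[of k "?c * z"] real_part_scaleR[of t ?c]]
          generically_conj[OF real_part_minus[of "k *\<^sub>R (?c * z)" "t *\<^sub>R ?c"]
            real_part_idempotent_generic[of c]]]]
    by (rule generically_mono) (use assms in \<open>auto simp: indicator_def\<close>)
qed

lemma idempotent_in_C_Q: "idempotent_of c \<in> C_Q"
  by (simp add: C_Q_def Rep_idem indicator_def)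

lemma nonzero_on_clopen:
  fixes x :: "'b::complete_bool_alg L0"
  assumes "x \<noteq> 0"
  obtains c where "c \<noteq> bot" "\<And>q. q \<in> stone_clopen c \<Longrightarrow> Rep_L0 x q \<noteq> 0"
proof -
  let ?W = "{q \<in> topspace stone_space. Rep_L0 x q \<in> - {0}}"
  have op: "openin stone_space ?W"
    by (rule openin_continuous_map_preimage[OF L0_continuous]) (simp add: open_Compl)
  have "?W \<noteq> {}"
  proof
    assume "?W = {}"
    then have "x = 0"
      by (intro L0_eqI generically_mono[OF stone_space_generic]) (auto simp: Rep_zero_L0)
    with assms show False by simp
  qed
  then obtain F where F: "F \<in> ?W" by blast
  obtain c where c: "F \<in> stone_clopen c" "stone_clopen c \<subseteq> ?W"
    using stone_base[OF op F] by blast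
  then have "c \<noteq> bot" using stone_clopen_eq_empty by blast
  with c(2) show ?thesis by (intro that) blast+
qed

text \<open>
  A strict inequality in the wrong direction would persist on a non-empty open set, which meets
  every dense set.
\<close>

lemma L0_leI:
  assumes "generically (\<lambda>q. Rep_L0 x q \<le> Rep_L0 y q)"
  shows "x \<le> y"
proof -
  obtain U where U: "dense_open_in stone_space U" "\<And>q. q \<in> U \<Longrightarrow> Rep_L0 x q \<le> Rep_L0 y q"
    using assms unfolding generically_def by blast
  let ?T = "topspace stone_space"
  let ?W = "\<Union>r. {q \<in> ?T. Rep_L0 x q \<in> {r<..}} \<inter> {q \<in> ?T. Rep_L0 y q \<in> {..<r}}"
  have "openin stone_space ?W"
  proof (rule openin_Union)
    fix V assume "V \<in> range (\<lambda>r. {q \<in> ?T. Rep_L0 x q \<in> {r<..}} \<inter> {q \<in> ?T. Rep_L0 y q \<in> {..<r}})"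
    then show "openin stone_space V"
      using openin_continuous_map_preimage[OF L0_continuous[of x]]
        openin_continuous_map_preimage[OF L0_continuous[of y]]
      by (elim imageE) (simp only: open_openin[symmetric] open_greaterThan open_lessThan openin_Int)
  qed
  moreover have "U \<inter> ?W = {}" using U(2) by force
  ultimately have W: "?W = {}"
    using U(1) unfolding dense_open_in_def dense_intersects_open by blast
  show ?thesis
    unfolding less_eq_L0_def
  proof (rule ballI, rule ccontr)
    fix q assume q: "q \<in> ?T" "\<not> Rep_L0 x q \<le> Rep_L0 y q"
    then obtain r where "Rep_L0 y q < r" "r < Rep_L0 x q"
      using dense[of "Rep_L0 y q" "Rep_L0 x q"] by (auto simp: not_le)
    with q(1) W show False by blast
  qed
qed

lemma bounded_by_1:
  assumes "generically (\<lambda>q. \<bar>real_part w q\<bar> \<le> 1)"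
  shows bounded_by_1_in_C_Q: "w \<in> C_Q" and bounded_by_1_abs_mult_le: "\<bar>w * y\<bar> \<le> \<bar>y\<bar>"
proof -
  have "\<bar>w\<bar> \<le> idempotent_of top"
    using generically_conj[OF assms generically_conj[OF Rep_abs_generic[of w]
          generically_conj[OF stone_space_generic real_part_generic[of w]]]]
    by (intro L0_leI) (erule generically_mono,
       auto simp: Rep_idem stone_clopen_def ultrafilterD(1) topspace_stone)
  then have "\<bar>Rep_L0 w q\<bar> \<le> 1" if "q \<in> topspace stone_space" for q
    using that Rep_abs_L0[OF that, of w]
    by (auto simp: less_eq_L0_def Rep_idem stone_clopen_def ultrafilterD(1) topspace_stone)
  then show "w \<in> C_Q" by (force simp: C_Q_def)
  show "\<bar>w * y\<bar> \<le> \<bar>y\<bar>"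
    using generically_conj[OF assms generically_conj[OF generically_conj[OF
          Rep_abs_generic[of y] Rep_abs_generic[of "w * y"]] real_part_times[of w y]]]
    by (intro L0_leI) (erule generically_mono,
       auto simp: abs_mult mult_left_le_one_le)
qed

lemma real_part_idempotent_le_1: "generically (\<lambda>q. \<bar>real_part (idempotent_of c) q\<bar> \<le> 1)"
  using real_part_idempotent_generic[of c] by (rule generically_mono) (simp add: indicator_def)

section \<open>Elements given by locally constant data\<close>

lemma locally_constant_continuous_map:
  fixes f :: "'a \<Rightarrow> 'c::topological_space"
  assumes U: "openin T U"
    and loc: "\<And>q. q \<in> U \<Longrightarrow> \<exists>V. openin T V \<and> q \<in> V \<and> V \<subseteq> U \<and> (\<forall>p\<in>V. f p = f q)"
  shows "continuous_map (subtopology T U) euclidean f"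
proof -
  have top: "topspace (subtopology T U) = U"
    using openin_subset[OF U] by (simp add: Int_absorb1)
  have "openin T {q \<in> U. f q \<in> W}" for W
  proof (subst openin_subopen, rule ballI)
    fix q assume q: "q \<in> {q \<in> U. f q \<in> W}"
    then obtain V where V: "openin T V" "q \<in> V" "V \<subseteq> U" "\<forall>p\<in>V. f p = f q"
      using loc[of q] by blast
    have "V \<subseteq> {q \<in> U. f q \<in> W}"
    proof
      fix p assume p: "p \<in> V"
      then have "f p = f q" using V(4) by blast
      with p q V(3) show "p \<in> {q \<in> U. f q \<in> W}" by auto
    qed
    with V(1,2) show "\<exists>V. openin T V \<and> q \<in> V \<and> V \<subseteq> {q \<in> U. f q \<in> W}" by blast
  qed
  then have "openin (subtopology T U) {q \<in> topspace (subtopology T U). f q \<in> W}" for W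
    unfolding top openin_open_subtopology[OF U] by blast
  then show ?thesis by (simp add: continuous_map)
qed

text \<open>
  This is where universal completeness enters: the values \<open>k n\<close> may be unbounded, so the glued
  function may become infinite at boundary points of the union of the pieces. Prescribing \<open>0\<close>
  off the supremum of the pieces makes the domain dense.
\<close>

lemma disjoint_gluing:
  fixes e :: "nat \<Rightarrow> 'b::complete_bool_alg" and k :: "nat \<Rightarrow> real"
  assumes disj: "\<And>m n. m \<noteq> n \<Longrightarrow> inf (e m) (e n) = bot"
  obtains \<kappa> where "\<And>n. idempotent_of (e n) * \<kappa> = k n *\<^sub>R idempotent_of (e n)"
proof -
  define r where "r = - (SUP n. e n)"
  define P where "P = range (\<lambda>n. stone_clopen (e n)) \<union> {stone_clopen r}"
  define f where "f q = (if \<exists>n. q \<in> stone_clopen (e n)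
      then k (THE n. q \<in> stone_clopen (e n)) else 0)" for q
  have f_on: "f q = k n" if "q \<in> stone_clopen (e n)" for q n
  proof -
    have "m = n" if m: "q \<in> stone_clopen (e m)" for m
    proof (rule ccontr)
      assume "m \<noteq> n"
      then have "stone_clopen (inf (e m) (e n)) = {}"
        by (simp add: disj stone_clopen_eq_empty)
      with m \<open>q \<in> stone_clopen (e n)\<close> show False by (auto simp: stone_clopen_inf)
    qed
    then have "(THE n. q \<in> stone_clopen (e n)) = n" using that by (intro the_equality)
    with that show ?thesis unfolding f_def by auto
  qed
  have f_off: "f q = 0" if "q \<in> stone_clopen r" for q
  proof -
    have "q \<notin> stone_clopen (e n)" for n
    proof
      assume "q \<in> stone_clopen (e n)"
      then have "q \<in> stone_clopen (inf (e n) r)" using that by (simp add: stone_clopen_inf)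
      moreover have "inf (e n) r = bot"
        unfolding r_def by (simp add: inf_shunt SUP_upper)
      ultimately show False by (simp add: stone_clopen_eq_empty[THEN iffD2])
    qed
    then show ?thesis unfolding f_def by simp
  qed
  have oP: "openin stone_space V" if "V \<in> P" for V
    using that openin_stone_clopen unfolding P_def by blast
  have U: "dense_open_in stone_space (\<Union>P)"
  proof (rule dense_open_stoneI)
    show "openin stone_space (\<Union>P)" using oP by (rule openin_Union)
    fix b :: 'b assume b: "b \<noteq> bot"
    show "stone_clopen b \<inter> \<Union>P \<noteq> {}"
    proof
      assume emp: "stone_clopen b \<inter> \<Union>P = {}"
      have "stone_clopen (inf (e n) b) = {}" for n
        using emp unfolding P_def stone_clopen_inf by blast
      then have "e n \<le> - b" for n by (simp add: stone_clopen_eq_empty inf_shunt)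
      then have "(SUP n. e n) \<le> - b" by (rule SUP_least)
      moreover have "stone_clopen (inf r b) = {}"
        using emp unfolding P_def stone_clopen_inf by blast
      then have "r \<le> - b" by (simp add: stone_clopen_eq_empty inf_shunt)
      ultimately have "sup (SUP n. e n) (- (SUP n. e n)) \<le> - b"
        unfolding r_def by (rule sup_least)
      then have "- b = top" by (simp add: top_unique)
      with b show False by (metis compl_top_eq double_compl)
    qed
  qed
  have "\<exists>V. openin stone_space V \<and> q \<in> V \<and> V \<subseteq> \<Union>P \<and> (\<forall>p\<in>V. ereal (f p) = ereal (f q))"
    if q: "q \<in> \<Union>P" for q
  proof -
    obtain V where "V \<in> P" "q \<in> V" using q by blast
    moreover have "f p = f q" if "p \<in> V" for p
      using \<open>V \<in> P\<close> \<open>q \<in> V\<close> that f_on f_off unfolding P_def by force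
    moreover have "V \<subseteq> \<Union>P" using \<open>V \<in> P\<close> by (rule Union_upper)
    ultimately show ?thesis
      using oP[OF \<open>V \<in> P\<close>] by (intro exI[of _ V] conjI ballI arg_cong[of _ _ ereal])
  qed
  then have "continuous_map (subtopology stone_space (\<Union>P)) euclidean (\<lambda>q. ereal (f q))"
    using U unfolding dense_open_in_def by (intro locally_constant_continuous_map) blast+
  from extension_exists[OF U this]
  obtain \<kappa> where \<kappa>: "\<And>q. q \<in> \<Union>P \<Longrightarrow> Rep_L0 \<kappa> q = ereal (f q)" by auto
  have "idempotent_of (e n) * \<kappa> = k n *\<^sub>R idempotent_of (e n)" for n
  proof -
    have "real_part \<kappa> q = k n" if "q \<in> stone_clopen (e n)" for q
    proof -
      have "q \<in> \<Union>P" using that unfolding P_def by blast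
      then show ?thesis using \<kappa> f_on[OF that] by (simp add: real_part_def)
    qed
    \<comment> \<open>A constant is an affine function of slope \<open>0\<close>.\<close>
    then show ?thesis
      using idempotent_mult_affineI[of "e n" \<kappa> 0 \<kappa> "- k n"] by simp
  qed
  then show ?thesis by (rule that)
qed

text \<open>
  The fractional part of \<open>z\<close> is discontinuous only where \<open>z\<close> crosses an integer. The points at
  which \<open>z\<close> is finite and not an integer, together with the interior of the set where it is an
  integer, form a dense open set on which the integer part is locally constant.
\<close>

lemma fractional_part_exists:
  fixes z :: "'b::complete_bool_alg L0"
  obtains w where "generically (\<lambda>q. \<bar>real_part w q\<bar> \<le> 1)"
    and "generically (\<lambda>q. \<exists>c t. q \<in> stone_clopen c \<and>
           idempotent_of c * w = idempotent_of c * z - t *\<^sub>R idempotent_of c)"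
proof -
  obtain D where D: "dense_open_in stone_space D"
     "continuous_map (subtopology stone_space D) euclideanreal (real_part z)"
    using real_part_continuous[of z] by blast
  define r where "r = real_part z"
  have oD: "openin stone_space D" using D(1) by (simp add: dense_open_in_def)
  have DT: "D \<subseteq> topspace stone_space" using oD by (rule openin_subset)
  have pre: "openin stone_space {q \<in> D. r q \<in> V}" if "open V" for V
  proof -
    have "openin (subtopology stone_space D) {q \<in> topspace (subtopology stone_space D). r q \<in> V}"
      using D(2) that unfolding r_def by (intro openin_continuous_map_preimage) auto
    moreover have "{q \<in> topspace (subtopology stone_space D). r q \<in> V} = {q \<in> D. r q \<in> V}"
      using DT by auto
    ultimately show ?thesis using openin_open_subtopology[OF oD] by metis
  qed
  define A where "A = {q \<in> D. r q \<in> - \<int>}"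
  define B where "B = stone_space interior_of {q \<in> D. r q \<in> \<int>}"
  have BD: "B \<subseteq> {q \<in> D. r q \<in> \<int>}" unfolding B_def by (rule interior_of_subset)
  have oA: "openin stone_space A"
    unfolding A_def by (rule pre) (simp add: open_Compl closed_Ints)
  have oB: "openin stone_space B" unfolding B_def by simp
  have U: "dense_open_in stone_space (A \<union> B)"
  proof (rule dense_open_stoneI)
    show "openin stone_space (A \<union> B)" using oA oB by (rule openin_Un)
    fix b :: 'b assume "b \<noteq> bot"
    then have ne: "D \<inter> stone_clopen b \<noteq> {}"
      using D(1) openin_stone_clopen[of b] stone_clopen_eq_empty[of b]
      unfolding dense_open_in_def dense_intersects_open by blast
    show "stone_clopen b \<inter> (A \<union> B) \<noteq> {}"
    proof
      assume emp: "stone_clopen b \<inter> (A \<union> B) = {}"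
      then have "D \<inter> stone_clopen b \<subseteq> {q \<in> D. r q \<in> \<int>}" unfolding A_def by blast
      then have "D \<inter> stone_clopen b \<subseteq> B"
        unfolding B_def using oD openin_stone_clopen by (intro interior_of_maximal openin_Int)
      with emp ne show False by blast
    qed
  qed
  have loc: "\<exists>V. openin stone_space V \<and> q \<in> V \<and> V \<subseteq> A \<union> B \<and> (\<forall>p\<in>V. \<lfloor>r p\<rfloor> = \<lfloor>r q\<rfloor>)"
    if q: "q \<in> A \<union> B" for q
  proof (cases "q \<in> A")
    case True
    let ?V = "{p \<in> D. r p \<in> {of_int \<lfloor>r q\<rfloor><..<of_int \<lfloor>r q\<rfloor> + 1}}"
    have "of_int \<lfloor>r q\<rfloor> \<noteq> r q"
      using True unfolding A_def by (metis (mono_tags, lifting) ComplD Ints_of_int mem_Collect_eq)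
    then have "of_int \<lfloor>r q\<rfloor> < r q" by (simp add: order_less_le)
    then have "q \<in> ?V" using True by (auto simp: A_def)
    moreover have "?V \<subseteq> A"
    proof
      fix p assume p: "p \<in> ?V"
      have "r p \<notin> \<int>"
      proof
        assume "r p \<in> \<int>"
        then obtain j where "r p = of_int j" by (auto elim: Ints_cases)
        with p show False by auto
      qed
      with p show "p \<in> A" by (simp add: A_def)
    qed
    moreover have "\<lfloor>r p\<rfloor> = \<lfloor>r q\<rfloor>" if "p \<in> ?V" for p
      using that by (intro floor_unique) auto
    moreover have "openin stone_space ?V" by (rule pre) simp
    ultimately show ?thesis by (intro exI[of _ ?V]) blast
  next
    case False
    let ?V = "B \<inter> {p \<in> D. r p \<in> {r q - 1<..<r q + 1}}"
    have qB: "q \<in> B" using False q by blast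
    have "\<lfloor>r p\<rfloor> = \<lfloor>r q\<rfloor>" if p: "p \<in> ?V" for p
    proof -
      have "r p \<in> \<int>" "r q \<in> \<int>" using p qB BD by auto
      then obtain i j where "r p = of_int i" "r q = of_int j" by (auto elim!: Ints_cases)
      with p show ?thesis by auto
    qed
    moreover have "openin stone_space ?V" by (intro openin_Int oB pre) simp
    moreover have "q \<in> ?V" using qB BD by auto
    ultimately show ?thesis by (intro exI[of _ ?V]) blast
  qed
  have UT: "A \<union> B \<subseteq> topspace stone_space" "A \<union> B \<subseteq> D"
    using BD DT by (auto simp: A_def)
  have "continuous_map (subtopology stone_space (A \<union> B)) euclideanreal (\<lambda>q. of_int \<lfloor>r q\<rfloor>)"
  proof (rule locally_constant_continuous_map)
    show "openin stone_space (A \<union> B)" using oA oB by (rule openin_Un)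
    fix q assume "q \<in> A \<union> B"
    then obtain V where "openin stone_space V" "q \<in> V" "V \<subseteq> A \<union> B" "\<forall>p\<in>V. \<lfloor>r p\<rfloor> = \<lfloor>r q\<rfloor>"
      using loc by blast
    then show "\<exists>V. openin stone_space V \<and> q \<in> V \<and> V \<subseteq> A \<union> B \<and>
        (\<forall>p\<in>V. real_of_int \<lfloor>r p\<rfloor> = real_of_int \<lfloor>r q\<rfloor>)"
      by (intro exI[of _ V] conjI ballI arg_cong[of _ _ real_of_int]) blast+
  qed
  moreover have "continuous_map (subtopology stone_space (A \<union> B)) euclideanreal r"
    using continuous_map_from_subtopology_mono[OF D(2) UT(2)] by (simp add: r_def)
  ultimately have "continuous_map (subtopology stone_space (A \<union> B)) euclideanreal (\<lambda>q. frac (r q))"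
    unfolding frac_def by (intro continuous_map_diff)
  then have "continuous_map (subtopology stone_space (A \<union> B)) euclidean (ereal \<circ> (\<lambda>q. frac (r q)))"
    by (rule continuous_map_compose) (auto intro: continuous_intros)
  from extension_exists[OF U this]
  obtain w where w: "\<And>q. q \<in> A \<union> B \<Longrightarrow> Rep_L0 w q = ereal (frac (r q))" by auto
  show ?thesis
  proof (rule that)
    show "generically (\<lambda>q. \<bar>real_part w q\<bar> \<le> 1)"
      unfolding generically_def
      using U w by (intro exI[of _ "A \<union> B"]) (auto simp: real_part_def frac_ge_0 less_imp_le[OF frac_lt_1])
    have "\<exists>c t. q \<in> stone_clopen c \<and>
        idempotent_of c * w = idempotent_of c * z - t *\<^sub>R idempotent_of c"
      if q: "q \<in> A \<union> B" for q
    proof -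
      obtain V where V: "openin stone_space V" "q \<in> V" "V \<subseteq> A \<union> B"
        "\<And>p. p \<in> V \<Longrightarrow> \<lfloor>r p\<rfloor> = \<lfloor>r q\<rfloor>"
        using loc[OF q] by blast
      obtain c where c: "q \<in> stone_clopen c" "stone_clopen c \<subseteq> V"
        using stone_base[OF V(1,2)] by blast
      let ?t = "real_of_int \<lfloor>r q\<rfloor>"
      have "real_part w p = real_part z p - ?t" if "p \<in> stone_clopen c" for p
      proof -
        have "p \<in> V" using that c(2) by blast
        then have "real_part w p = frac (r p)" using w[of p] V(3) by (auto simp: real_part_def[of w])
        with V(4)[OF \<open>p \<in> V\<close>] show ?thesis by (simp add: frac_def r_def)
      qed
      then have "idempotent_of c * w = idempotent_of c * z - ?t *\<^sub>R idempotent_of c"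
        using idempotent_mult_affineI[of c w 1 z ?t] by simp
      with c(1) show ?thesis by blast
    qed
    then show "generically (\<lambda>q. \<exists>c t. q \<in> stone_clopen c \<and>
        idempotent_of c * w = idempotent_of c * z - t *\<^sub>R idempotent_of c)"
      unfolding generically_def using U by blast
  qed
qed

section \<open>Atoms and disjoint sequences in Boolean algebras\<close>

lemma atom_ultrafilter_unique:
  assumes atom: "\<And>b. b \<le> p \<Longrightarrow> b = bot \<or> b = p"
    and "F \<in> stone_clopen p" "G \<in> stone_clopen p"
  shows "F = G"
proof -
  have *: "b \<in> G" if F: "F \<in> stone_clopen p" and G: "G \<in> stone_clopen p" and b: "b \<in> F" for F G b
  proof -
    have "inf p b \<in> F" using F b by (auto simp: stone_clopen_def intro: ultrafilterD(3))
    then have "inf p b \<noteq> bot" using F by (auto simp: stone_clopen_def dest: ultrafilterD(2))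
    then have "inf p b = p" using atom[of "inf p b"] by auto
    then have "p \<le> b" by (simp add: inf.absorb_iff1)
    with G show ?thesis by (auto simp: stone_clopen_def intro: ultrafilterD(4))
  qed
  show ?thesis using *[OF assms(2,3)] *[OF assms(3,2)] by blast
qed

text \<open>
  Splitting repeatedly below \<open>f\<close> gives a strictly decreasing sequence; its successive differences are the
  pieces.
\<close>

lemma atomless_disjoint_sequence:
  fixes f :: "'b::boolean_algebra"
  assumes "f \<noteq> bot"
    and split: "\<And>p. p \<le> f \<Longrightarrow> p \<noteq> bot \<Longrightarrow> \<exists>b\<le>p. b \<noteq> bot \<and> b \<noteq> p"
  shows "\<exists>e :: nat \<Rightarrow> 'b. (\<forall>n. e n \<noteq> bot \<and> e n \<le> f) \<and>
    (\<forall>m n. m \<noteq> n \<longrightarrow> inf (e m) (e n) = bot)"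
proof -
  have "\<exists>p. \<forall>n. (p n \<le> f \<and> p n \<noteq> bot) \<and> (p (Suc n) \<le> p n \<and> p (Suc n) \<noteq> p n)"
  proof (rule dependent_nat_choice)
    show "\<exists>x. x \<le> f \<and> x \<noteq> bot" using assms(1) by blast
    fix x :: 'b assume "x \<le> f \<and> x \<noteq> bot"
    then show "\<exists>y. (y \<le> f \<and> y \<noteq> bot) \<and> y \<le> x \<and> y \<noteq> x"
      using split[of x] order_trans by blast
  qed
  then obtain p where p: "\<And>n. p n \<le> f" "\<And>n. p (Suc n) \<le> p n" "\<And>n. p (Suc n) \<noteq> p n" by blast
  have dec: "p n \<le> p m" if "m \<le> n" for m n
    using p(2) that by (rule lift_Suc_antimono_le)
  let ?e = "\<lambda>n. inf (p n) (- p (Suc n))"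
  have "inf (?e m) (?e n) = bot" if "m < n" for m n
  proof -
    have "inf (?e m) (?e n) \<le> inf (- p (Suc m)) (p (Suc m))"
      using dec[of "Suc m" n] that by (intro inf_mono) (auto intro: le_infI1 order_trans)
    then show ?thesis by (simp add: bot_unique)
  qed
  then have disj: "inf (?e m) (?e n) = bot" if "m \<noteq> n" for m n
    using that by (metis inf_commute linorder_neqE_nat)
  have "?e n \<noteq> bot" for n
    using p(2,3)[of n] by (auto simp: inf_shunt intro: antisym)
  moreover have "?e n \<le> f" for n using p(1) by (rule le_infI1)
  ultimately show ?thesis using disj by (intro exI[of _ ?e]) simp
qed

section \<open>Band preserving derivations\<close>

locale band_preserving_derivation =
  fixes X Y :: "'b::complete_bool_alg L0 set" and \<delta> :: "'b L0 \<Rightarrow> 'b L0"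
  assumes ideal: "ideal_in_C_Q X"
    and derivation: "derivation_on X Y \<delta>"
    and band: "band_preserving_on X \<delta>"
begin

lemma subspace_X: "subspace X"
  using ideal by (simp add: ideal_in_C_Q_def)

lemma X_mult: "w \<in> C_Q \<Longrightarrow> a \<in> X \<Longrightarrow> w * a \<in> X" "a \<in> X \<Longrightarrow> b \<in> X \<Longrightarrow> a * b \<in> X"
  using ideal by (auto simp: ideal_in_C_Q_def)

lemma d_in: "a \<in> X \<Longrightarrow> \<delta> a \<in> Y"
  and d_add: "a \<in> X \<Longrightarrow> b \<in> X \<Longrightarrow> \<delta> (a + b) = \<delta> a + \<delta> b"
  and d_scaleR: "a \<in> X \<Longrightarrow> \<delta> (t *\<^sub>R a) = t *\<^sub>R \<delta> a"
  and d_mult: "a \<in> X \<Longrightarrow> b \<in> X \<Longrightarrow> \<delta> (a * b) = \<delta> a * b + a * \<delta> b"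
  using derivation by (auto simp: derivation_on_def)

lemma d_diff:
  assumes "a \<in> X" "b \<in> X"
  shows "\<delta> (a - b) = \<delta> a - \<delta> b"
proof -
  have "\<delta> (a + (- 1) *\<^sub>R b) = \<delta> a + (- 1) *\<^sub>R \<delta> b"
    using assms subspace_X by (simp only: d_add d_scaleR subspace_scale)
  then show ?thesis by simp
qed

text \<open>
  Band preservation in its multiplicative form. The support only yields that \<open>e\<close> lies below a
  supremum of idempotents annihilating \<open>\<delta> a\<close>; that \<open>e\<close> itself annihilates it needs the
  continuity of \<open>\<delta> a\<close>.
\<close>

lemma d_vanishes:
  assumes "a \<in> X" "idempotent_of e * a = 0"
  shows "idempotent_of e * \<delta> a = 0"
proof -
  define S where "S = {b. idempotent_of b * \<delta> a = 0}"
  have "support (\<delta> a) \<le> support a"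
    using band assms(1) by (simp add: band_preserving_on_def)
  then have "- Sup S \<le> - Sup {b. idempotent_of b * a = 0}"
    by (simp add: support_def S_def diff_eq)
  moreover have "e \<le> Sup {b. idempotent_of b * a = 0}" using assms(2) by (auto intro: Sup_upper)
  ultimately have "e \<le> Sup S" by (simp add: order_trans)
  have "Rep_L0 (\<delta> a) q = 0" if q: "q \<in> stone_clopen e" for q
  proof -
    have qT: "q \<in> topspace stone_space"
      using q openin_subset[OF openin_stone_clopen[of e]] by blast
    have "q \<in> stone_clopen (Sup S)"
      using q \<open>e \<le> Sup S\<close> by (auto simp: stone_clopen_def intro: ultrafilterD(4))
    then have "q \<in> stone_space closure_of (\<Union>b\<in>S. stone_clopen b)"
      using stone_clopen_Sup_subset by blast
    then have "Rep_L0 (\<delta> a) q = Rep_L0 0 q"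
    proof (rule Rep_eq_on_closure)
      fix p assume "p \<in> (\<Union>b\<in>S. stone_clopen b)"
      then obtain b where "b \<in> S" "p \<in> stone_clopen b" by blast
      then show "Rep_L0 (\<delta> a) p = Rep_L0 0 p"
        using openin_subset[OF openin_stone_clopen[of b]]
        by (auto simp: S_def idempotent_mult_eq_0_iff Rep_zero_L0)
    qed
    then show ?thesis by (simp add: Rep_zero_L0[OF qT])
  qed
  then show ?thesis by (simp add: idempotent_mult_eq_0_iff)
qed

text \<open>
  Split \<open>a\<close> into its parts on \<open>e\<close> and on the complement; by band preservation the image of each
  part stays on its own side.
\<close>

lemma d_idempotent_mult:
  assumes "a \<in> X"
  shows "\<delta> (idempotent_of e * a) = idempotent_of e * \<delta> a"
proof -
  have X: "idempotent_of c * a \<in> X" for c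
    using assms idempotent_in_C_Q by (rule X_mult(1)[rotated])
  have "idempotent_of e * \<delta> (idempotent_of (- e) * a) = 0"
    by (rule d_vanishes[OF X idempotent_mult_disjoint]) simp
  moreover have "idempotent_of (- e) * \<delta> (idempotent_of e * a) = 0"
    by (rule d_vanishes[OF X idempotent_mult_disjoint]) simp
  then have "idempotent_of e * \<delta> (idempotent_of e * a) = \<delta> (idempotent_of e * a)"
    using idempotent_mult_compl[of e "\<delta> (idempotent_of e * a)"] by simp
  moreover have "\<delta> a = \<delta> (idempotent_of e * a) + \<delta> (idempotent_of (- e) * a)"
    using d_add[OF X[of e] X[of "- e"]] by (simp add: idempotent_mult_compl)
  ultimately show ?thesis by (simp add: distrib_left)
qed

text \<open>
  On the clopen set of \<open>c\<close> the product \<open>w a\<close> is \<open>k a\<^sup>2 - t a\<close>, whose derivative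
  \<open>2 k a \<delta> a - t \<delta> a\<close> is rewritten by \<open>k a - t = w\<close>. The constant \<open>t\<close> thus disappears
  from the result, and only the bounded factor \<open>w\<close> and the amplification \<open>k\<close> remain. Everything is
  multiplied by \<open>a\<close>, since \<open>\<delta>\<close> is only given on the ideal.
\<close>

lemma d_affine:
  assumes "a \<in> X" "w \<in> C_Q"
    and aff: "idempotent_of c * w = k *\<^sub>R (idempotent_of c * a) - t *\<^sub>R idempotent_of c"
  shows "idempotent_of c * \<delta> (w * a) = idempotent_of c * (k *\<^sub>R (a * \<delta> a) + w * \<delta> a)"
proof -
  let ?c = "idempotent_of c"
  note X = subspace_scale[OF subspace_X] X_mult assms(1,2) idempotent_in_C_Q
  have "?c * (w * a) = (?c * w) * a" by (simp add: mult.assoc)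
  also have "\<dots> = k *\<^sub>R (?c * (a * a)) - t *\<^sub>R (?c * a)"
    by (simp add: aff left_diff_distrib mult.assoc)
  finally have "\<delta> (?c * (w * a)) = \<delta> (k *\<^sub>R (?c * (a * a)) - t *\<^sub>R (?c * a))" by simp
  also have "\<dots> = k *\<^sub>R \<delta> (?c * (a * a)) - t *\<^sub>R \<delta> (?c * a)"
    by (simp add: d_diff d_scaleR X)
  also have "\<dots> = k *\<^sub>R (?c * (\<delta> a * a + a * \<delta> a)) - t *\<^sub>R (?c * \<delta> a)"
    by (simp add: d_idempotent_mult d_mult X)
  also have "\<dots> = ?c * (k *\<^sub>R (a * \<delta> a)) + (k *\<^sub>R (?c * a) - t *\<^sub>R ?c) * \<delta> a"
    by (simp add: algebra_simps)
  also have "\<dots> = ?c * (k *\<^sub>R (a * \<delta> a)) + (?c * w) * \<delta> a" by (simp only: aff)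
  also have "\<dots> = ?c * (k *\<^sub>R (a * \<delta> a) + w * \<delta> a)"
    by (simp add: distrib_left mult.assoc)
  finally show ?thesis by (simp add: d_idempotent_mult X)
qed

text \<open>The square of \<open>a\<close> lies in the ideal, and \<open>\<delta>\<close> maps it to \<open>2 a \<delta> a\<close>.\<close>

lemma mult_d_in:
  assumes "subspace Y" "a \<in> X"
  shows "a * \<delta> a \<in> Y"
proof -
  have "(1/2) *\<^sub>R \<delta> (a * a) \<in> Y"
    using assms by (intro subspace_scale d_in X_mult)
  moreover have "(1/2) *\<^sub>R \<delta> (a * a) = a * \<delta> a"
  proof -
    have "\<delta> (a * a) = a * \<delta> a + a * \<delta> a"
      using assms(2) by (simp add: d_mult mult.commute)
    then show ?thesis
      by (metis scaleR_half_double)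
  qed
  ultimately show ?thesis by simp
qed

text \<open>
  If the product vanished, then \<open>a\<close> would vanish on a clopen set on which \<open>\<delta> a\<close> has no zero,
  contrary to band preservation.
\<close>

lemma mult_d_nonzero:
  assumes "a \<in> X" "\<delta> a \<noteq> 0"
  shows "a * \<delta> a \<noteq> 0"
proof
  assume z: "a * \<delta> a = 0"
  obtain c where c: "c \<noteq> bot" "\<And>q. q \<in> stone_clopen c \<Longrightarrow> Rep_L0 (\<delta> a) q \<noteq> 0"
    using nonzero_on_clopen[OF assms(2)] by blast
  have "idempotent_of c * a = 0"
    using generically_conj[OF generically_conj[OF real_part_times[of "idempotent_of c" a]
          real_part_times[of a "\<delta> a"]]
        generically_conj[OF generically_conj[OF real_part_idempotent_generic[of c]
          real_part_zero] real_part_generic[of "\<delta> a"]]]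
    by (intro L0_eqI_real) (erule generically_mono,
       use c(2) in \<open>force simp: z indicator_def zero_ereal_def\<close>)
  then have "idempotent_of c * \<delta> a = 0" using assms(1) by (rule d_vanishes[rotated])
  then have "stone_clopen c = {}" using c(2) by (auto simp: idempotent_mult_eq_0_iff)
  with c(1) show False by (simp add: stone_clopen_eq_empty)
qed

text \<open>The clopen set of an atom is a single point, so \<open>a\<close> is constant on it.\<close>

lemma mult_d_zero_on_atom:
  assumes "a \<in> X" and atom: "\<And>b. b \<le> p \<Longrightarrow> b = bot \<or> b = p"
  shows "idempotent_of p * (a * \<delta> a) = 0"
proof (cases "p = bot")
  case True
  then show ?thesis by (simp add: idempotent_bot_mult)
next
  case False
  then obtain F where F: "F \<in> stone_clopen p" using stone_clopen_eq_empty by blast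
  have pT: "stone_clopen p \<subseteq> topspace stone_space"
    using openin_stone_clopen by (rule openin_subset)
  \<comment> \<open>The constancy of \<open>a\<close> is read as: the zero function is affine in \<open>a\<close> with slope \<open>1\<close>.\<close>
  have "real_part 0 q = 1 * real_part a q - real_part a F" if "q \<in> stone_clopen p" for q
    using atom_ultrafilter_unique[OF atom that F] F pT by (auto simp: real_part_def Rep_zero_L0)
  then have "idempotent_of p * 0 = 1 *\<^sub>R (idempotent_of p * a) - real_part a F *\<^sub>R idempotent_of p"
    by (rule idempotent_mult_affineI)
  moreover have "0 \<in> C_Q" by (simp add: C_Q_def Rep_zero_L0)
  ultimately have "idempotent_of p * \<delta> (0 * a) = idempotent_of p * (1 *\<^sub>R (a * \<delta> a) + 0 * \<delta> a)"
    using assms(1) by (intro d_affine)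
  moreover have "\<delta> 0 = 0" using d_scaleR[OF assms(1), of 0] by simp
  ultimately show ?thesis by simp
qed

text \<open>
  The witness is the fractional part of \<open>\<kappa> a\<close>, where \<open>\<kappa>\<close> equals \<open>k n\<close> on \<open>e n\<close>. It stays bounded
  however fast \<open>k\<close> grows, so that \<open>w a\<close> belongs to the ideal. The integer part is constant only
  locally, hence \<open>d_affine\<close> is applied on small clopen sets that together are dense.
\<close>

lemma d_amplified:
  assumes "a \<in> X" and disj: "\<And>m n. m \<noteq> n \<Longrightarrow> inf (e m) (e n) = bot"
  shows "\<exists>w. generically (\<lambda>q. \<bar>real_part w q\<bar> \<le> 1) \<and>
    (\<forall>n::nat. idempotent_of (e n) * \<delta> (w * a)
       = idempotent_of (e n) * (k n *\<^sub>R (a * \<delta> a) + w * \<delta> a))"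
proof -
  obtain \<kappa> where \<kappa>: "\<And>n. idempotent_of (e n) * \<kappa> = k n *\<^sub>R idempotent_of (e n)"
    by (rule disjoint_gluing[OF disj, where k = k]) auto
  obtain w where w1: "generically (\<lambda>q. \<bar>real_part w q\<bar> \<le> 1)"
    and w2: "generically (\<lambda>q. \<exists>c t. q \<in> stone_clopen c \<and>
           idempotent_of c * w = idempotent_of c * (\<kappa> * a) - t *\<^sub>R idempotent_of c)"
    by (rule fractional_part_exists)
  have w: "w \<in> C_Q" using w1 by (rule bounded_by_1_in_C_Q)
  have "idempotent_of (e n) * \<delta> (w * a)
      = idempotent_of (e n) * (k n *\<^sub>R (a * \<delta> a) + w * \<delta> a)" (is "?l = ?r") for n
  proof (rule L0_eqI, rule generically_mono[OF w2], elim exE conjE)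
    fix q c t assume q: "q \<in> stone_clopen c"
      and c: "idempotent_of c * w = idempotent_of c * (\<kappa> * a) - t *\<^sub>R idempotent_of c"
    let ?g = "idempotent_of (inf c (e n))"
    have gc: "?g = idempotent_of (e n) * idempotent_of c"
      by (simp add: idempotent_of_inf mult.commute)
    have "?g * w = idempotent_of (e n) * (idempotent_of c * w)" by (simp add: gc mult.assoc)
    also have "\<dots> = (idempotent_of (e n) * \<kappa>) * (idempotent_of c * a) - t *\<^sub>R ?g"
      unfolding c gc by (simp add: right_diff_distrib mult_ac)
    also have "\<dots> = k n *\<^sub>R (?g * a) - t *\<^sub>R ?g"
      unfolding \<kappa> by (simp add: gc mult.assoc)
    finally have "?g * \<delta> (w * a) = ?g * (k n *\<^sub>R (a * \<delta> a) + w * \<delta> a)"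
      using assms(1) w by (intro d_affine)
    then have "idempotent_of c * ?l = idempotent_of c * ?r" by (simp add: gc mult_ac)
    with q show "Rep_L0 ?l q = Rep_L0 ?r q" by (simp add: idempotent_mult_eq_iff)
  qed
  with w1 show ?thesis by blast
qed

end

section \<open>Vanishing of band preserving derivations\<close>

theorem theorem5p3:
  fixes X Y :: "'b::complete_bool_alg L0 set"
    and N :: "'b L0 \<Rightarrow> real"
    and \<delta> :: "'b L0 \<Rightarrow> 'b L0"
  assumes "ideal_in_C_Q X"
    and "quasi_normed_solid_space Y N"
    and "derivation_on X Y \<delta>"
    and "band_preserving_on X \<delta>"
  shows "\<forall>x\<in>X. \<delta> x = 0"
proof (rule ballI, rule ccontr)
  fix a assume a: "a \<in> X" and da: "\<delta> a \<noteq> 0"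
  interpret band_preserving_derivation X Y \<delta>
    using assms by unfold_locales
  have Y: "subspace Y" and solid: "\<And>x y. x \<in> Y \<Longrightarrow> \<bar>y\<bar> \<le> \<bar>x\<bar> \<Longrightarrow> y \<in> Y"
    and mono: "\<And>x y. x \<in> Y \<Longrightarrow> \<bar>y\<bar> \<le> \<bar>x\<bar> \<Longrightarrow> N y \<le> N x"
    using assms(2) unfolding quasi_normed_solid_space_def solid_space_def by blast+
  obtain C where C: "C \<ge> 1" and N0: "\<And>x. x \<in> Y \<Longrightarrow> N x \<ge> 0 \<and> (N x = 0 \<longleftrightarrow> x = 0)"
    and Nscale: "\<And>x t. x \<in> Y \<Longrightarrow> N (t *\<^sub>R x) = \<bar>t\<bar> * N x"
    and Nadd: "\<And>x y. x \<in> Y \<Longrightarrow> y \<in> Y \<Longrightarrow> N (x + y) \<le> C * (N x + N y)"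
  proof -
    have "quasi_norm_on Y N" using assms(2) by (simp add: quasi_normed_solid_space_def)
    then show ?thesis unfolding quasi_norm_on_def by (elim exE conjE) (rule that, auto)
  qed
  define u where "u = a * \<delta> a"
  have uY: "u \<in> Y" unfolding u_def using Y a by (rule mult_d_in)
  have "u \<noteq> 0" unfolding u_def using a da by (rule mult_d_nonzero)
  then obtain f where f: "f \<noteq> bot" "\<And>q. q \<in> stone_clopen f \<Longrightarrow> Rep_L0 u q \<noteq> 0"
    using nonzero_on_clopen by blast
  have nz: "idempotent_of p * u \<noteq> 0" if p: "p \<le> f" "p \<noteq> bot" for p
  proof
    assume "idempotent_of p * u = 0"
    moreover obtain F where F: "F \<in> stone_clopen p" using p(2) stone_clopen_eq_empty by blast
    moreover have "F \<in> stone_clopen f"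
      using F p(1) by (auto simp: stone_clopen_def intro: ultrafilterD(4))
    ultimately show False using f(2) by (auto simp: idempotent_mult_eq_0_iff)
  qed
  have "\<exists>b\<le>p. b \<noteq> bot \<and> b \<noteq> p" if "p \<le> f" "p \<noteq> bot" for p
    using mult_d_zero_on_atom[OF a, of p] nz[OF that] unfolding u_def by blast
  from atomless_disjoint_sequence[OF f(1) this]
  obtain e :: "nat \<Rightarrow> 'b" where e: "\<And>n. e n \<noteq> bot" "\<And>n. e n \<le> f"
    "\<And>m n. m \<noteq> n \<Longrightarrow> inf (e m) (e n) = bot"
    by blast
  \<comment> \<open>This choice gives \<open>k n (e n) u\<close> the norm \<open>n\<close>.\<close>
  define k where "k n = real n / N (idempotent_of (e n) * u)" for n
  obtain w where w: "generically (\<lambda>q. \<bar>real_part w q\<bar> \<le> 1)"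
    "\<And>n. idempotent_of (e n) * \<delta> (w * a) = idempotent_of (e n) * (k n *\<^sub>R u + w * \<delta> a)"
    using d_amplified[where e = e and k = k, OF a e(3)] unfolding u_def by blast
  note contract = bounded_by_1_abs_mult_le[OF w(1)]
    bounded_by_1_abs_mult_le[OF real_part_idempotent_le_1]
  have dw: "\<delta> (w * a) \<in> Y"
    using a bounded_by_1_in_C_Q[OF w(1)] by (intro d_in X_mult(1))
  have dY: "\<delta> a \<in> Y" using a by (rule d_in)
  have "real n \<le> C * (N (\<delta> (w * a)) + N (\<delta> a))" for n
  proof -
    let ?e = "idempotent_of (e n)"
    have euY: "?e * u \<in> Y" using uY contract(2) by (rule solid)
    have wdY: "w * \<delta> a \<in> Y" using dY contract(1) by (rule solid)
    have ewdY: "?e * (w * \<delta> a) \<in> Y" using wdY contract(2) by (rule solid)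
    have edwY: "?e * \<delta> (w * a) \<in> Y" using dw contract(2) by (rule solid)
    have pos: "N (?e * u) > 0"
      using N0[OF euY] nz[OF e(2,1)] by (simp add: less_le)
    have "real n = N (k n *\<^sub>R (?e * u))"
      using pos by (simp add: Nscale[OF euY] k_def)
    also have "k n *\<^sub>R (?e * u) = ?e * \<delta> (w * a) + (- 1) *\<^sub>R (?e * (w * \<delta> a))"
      unfolding w(2) by (simp add: distrib_left)
    also have "N \<dots> \<le> C * (N (?e * \<delta> (w * a)) + N ((- 1) *\<^sub>R (?e * (w * \<delta> a))))"
      using Y edwY ewdY by (intro Nadd subspace_scale)
    also have "N ((- 1) *\<^sub>R (?e * (w * \<delta> a))) = N (?e * (w * \<delta> a))"
      using Nscale[OF ewdY, of "- 1"] by simp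
    also have "C * (N (?e * \<delta> (w * a)) + N (?e * (w * \<delta> a))) \<le> C * (N (\<delta> (w * a)) + N (\<delta> a))"
    proof (intro mult_left_mono add_mono)
      show "N (?e * \<delta> (w * a)) \<le> N (\<delta> (w * a))" using dw contract(2) by (rule mono)
      have "N (?e * (w * \<delta> a)) \<le> N (w * \<delta> a)" using wdY contract(2) by (rule mono)
      also have "\<dots> \<le> N (\<delta> a)" using dY contract(1) by (rule mono)
      finally show "N (?e * (w * \<delta> a)) \<le> N (\<delta> a)" .
    qed (use C in simp)
    finally show ?thesis .
  qed
  then show False
    using reals_Archimedean2[of "C * (N (\<delta> (w * a)) + N (\<delta> a))"] by (meson not_le)
qed

end
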